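(* (Equations of motion, evolutional case.) Let $x=x(\xi,t)=x_t(\xi)$ describe a history (a smooth family of embeddings) of a $d$-dimensional body $\mathcal{B}$ (coordinates $\xi^\alpha$) in an $n$-dimensional manifold $\mathcal{M}$ (coordinates $x^A$), $t\in I=[0,1]$, and let $$\mathfrak{F}[x_t(\xi)]=\int_{\mathcal{B}\times I}\big(\mathcal{F}_0(\Delta,\dot\Delta)+\mathcal{U}(x_t(\xi))\big)\,\upsilon\,dt\wedge d\xi^1\wedge\dots\wedge d\xi^d,\qquad \upsilon=e(t)\,\varpi(\Theta^t_{\mathcal{B}}).$$ Then the extremality condition $\delta\mathfrak{F}=0$ under variation of $x_t(\xi)$ (the boundary terms of $\delta\mathfrak{F}$ being treated separately, as boundary conditions) gives the equations of motion $$\mathrm{div}\,\Sigma+f_{\Theta}+f_{\rm ext}=0,$$ where $$(\mathrm{div}\,\Sigma)_A=\frac1\upsilon\partial_\alpha\big(\upsilon\,\widetilde\Sigma^\alpha_A\big)=\frac1\varpi\partial_\alpha\big(\varpi\,\widetilde\Sigma^\alpha_A\big),\qquad (f_\Theta)_A=-\Sigma^{\alpha_1\dots\alpha_p}\,(\partial_A\Theta_{B_1\dots B_p})\,\partial_{\alpha_1}x^{B_1}\cdots\partial_{\alpha_p}x^{B_p},\qquad (f_{\rm ext})_A=-\partial_A\mathcal{U},$$ and the generalized stress tensor is $$\Sigma=\sigma-\dot\pi-\hat{\mathcal{T}}\,(\ln\varpi)_{|\Delta},\qquad \hat{\mathcal{T}}=\pi\otimes\dot\Delta-(\mathcal{F}_0+\mathcal{U})\,\hat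 I .$$
   Context: $\Theta=(\Theta_{B_1\dots B_p})$ is a smooth covariant tensor field of degree $p$ on $\mathcal{M}$, and $\Theta^t_{\mathcal{B}}=x_t^*\Theta$, with components $\Theta_{B_1\dots B_p}(x_t)\,\partial_{\alpha_1}x^{B_1}\cdots\partial_{\alpha_p}x^{B_p}$. It is assumed throughout that $p=2k$ is even, that $3^k-2kd^{k-1}=4m+1$ for some integer $m$, and that $\Theta^t_{\mathcal{B}}$ is nondegenerate (as a bilinear form on $k$-fold tensors), so that it induces a volume form $\varpi(\Theta^t_{\mathcal{B}})\,d\xi^1\wedge\dots\wedge d\xi^d$ on $\mathcal{B}$. The deformation measure is $\Delta=\Theta^t_{\mathcal{B}}-\Theta^0_{\mathcal{B}}$, and $\dot\Delta=d\Theta^t_{\mathcal{B}}/dt$. $\mathcal{F}_0$ is the internal elastic energy density, a scalar function of $\Delta,\dot\Delta$ (possibly also depending on $\xi$); $\mathcal{U}$ is the external potential energy, a function on $\mathcal{M}$; $e\,dt$ is a metric on $I$. The subscript $|\Delta$ denotes the derivative with respect to $\Delta$, and similarly $|\dot\Delta$; repeated indices are summed; a dot is the derivative in $t$. The stress tensor is $\sigma=(\mathcal{F}_0)_{|\Delta}$ and the surface momentum density tensor is $\pi=(\mathcal{F}_0)_{|\dot\Delta}$ (both with $p$ upper indices). $\hat{\mathcal{T}}$ is the deformational energy-momentum affinor, acting on tensors $w$ with $p$ upper indices by $\hat{\mathcal{T}}w=\pi\,\langle w,\dot\Delta\rangle-(\mathcal{F}_0+\mathcal{U})\,w$, where $\langle\,,\,\rangle$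 is full contraction; $\hat I$ is the identity operator. Finally $$\widetilde\Sigma^{\alpha}_A=\sum_{s=1}^p\Sigma^{\alpha_1\dots\alpha_{s-1}\,\alpha\,\alpha_{s+1}\dots\alpha_p}\,\Theta_{B_1\dots B_{s-1}\,A\,B_{s+1}\dots B_p}\prod_{r\neq s}\partial_{\alpha_r}x^{B_r}.$$ $f_\Theta$ is called the $\Theta$-gravity force density (it vanishes for constant $\Theta$) and $f_{\rm ext}$ the external force density.
   Formalization: For non-constant e(t) the displayed Σ lacks the term −(e′/e)π and the claim fails; there the dot on π is read as (1/e)d(eπ)/dt, and the literal dπ/dt is kept for constant e. Body and manifold are taken as single coordinate domains in R^d and R^n. *)

theory Defs
  imports "HOL-Analysis.Analysis"
begin

text \<open>
  The body and the ambient manifold are described in coordinates: points of the body are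
  \<open>\<xi> :: real^'d\<close>, points of the manifold are \<open>real^'n\<close>.
  With \<open>CARD('k) = k\<close>, the type \<open>'k + 'k\<close> names the \<open>p = 2k\<close> tensor slots, a multi-index is a
  function from slots to coordinate labels, and a tensor of degree \<open>p\<close> is the vector of its
  components, of type \<open>real^('k + 'k \<Rightarrow> 'd)\<close>.  The full contraction of tensors with upper and
  with lower indices is then the inner product.
\<close>

primrec Ck_on :: "nat \<Rightarrow> ('a::real_normed_vector \<Rightarrow> 'b::real_normed_vector) \<Rightarrow> 'a set \<Rightarrow> bool" where
  "Ck_on 0 f S \<longleftrightarrow> continuous_on S f"
| "Ck_on (Suc r) f S \<longleftrightarrow> (\<forall>x\<in>S. f differentiable (at x)) \<and>
     (\<forall>v. Ck_on r (\<lambda>x. frechet_derivative f (at x) v) S)"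

text \<open>Meant for open \<open>S\<close>; smoothness on a compact set is smoothness on an open neighbourhood.\<close>

definition smooth_on :: "('a::real_normed_vector \<Rightarrow> 'b::real_normed_vector) \<Rightarrow> 'a set \<Rightarrow> bool" where
  "smooth_on f S \<longleftrightarrow> (\<forall>r. Ck_on r f S)"

definition pd :: "'i::finite \<Rightarrow> (real^'i \<Rightarrow> 'b::real_normed_vector) \<Rightarrow> real^'i \<Rightarrow> 'b" where
  "pd i f v = frechet_derivative f (at v) (axis i 1)"

text \<open>The derivative of a scalar function of a tensor, as a tensor with the opposite index positions.\<close>

definition grad :: "(real^'i::finite \<Rightarrow> real) \<Rightarrow> real^'i \<Rightarrow> real^'i" where
  "grad f T = (\<chi> i. pd i f T)"

definition dt :: "(real \<Rightarrow> 'b::real_normed_vector) \<Rightarrow> real \<Rightarrow> 'b" where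
  "dt f t = vector_derivative f (at t)"

definition embedding_on :: "(real^'d::finite) set \<Rightarrow> (real^'d \<Rightarrow> real^'n::finite) \<Rightarrow> bool" where
  "embedding_on B f \<longleftrightarrow> embedding_map (top_of_set B) euclidean f \<and>
     (\<forall>\<xi>\<in>B. inj (frechet_derivative f (at \<xi>)))"

definition pullback ::
  "(real^'n::finite \<Rightarrow> real^('s::finite \<Rightarrow> 'n)) \<Rightarrow> (real^'d::finite \<Rightarrow> real^'n) \<Rightarrow> real^'d \<Rightarrow> real^('s \<Rightarrow> 'd)"
  where "pullback Theta f \<xi> =
    (\<chi> a. \<Sum>b\<in>UNIV. Theta (f \<xi>) $ b * (\<Prod>r\<in>UNIV. pd (a r) f \<xi> $ b r))"

definition tensor_matrix :: "real^('k::finite + 'k \<Rightarrow> 'd::finite) \<Rightarrow> real^('k \<Rightarrow> 'd)^('k \<Rightarrow> 'd)" where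
  "tensor_matrix T = (\<chi> a b. T $ case_sum a b)"

definition nondegenerate :: "real^('k::finite + 'k \<Rightarrow> 'd::finite) \<Rightarrow> bool" where
  "nondegenerate T \<longleftrightarrow> (\<forall>u. (\<forall>v. u \<bullet> (tensor_matrix T *v v) = 0) \<longrightarrow> u = 0)"

text \<open>
  Under a change of coordinates with Jacobian matrix \<open>J\<close> the matrix of \<open>T\<close> is transformed by the
  \<open>k\<close>-fold Kronecker power of \<open>J\<close>, so its determinant is multiplied by the power of \<open>det J\<close> with
  exponent \<open>2 k d^(k-1)\<close>; the root of that order is therefore the coefficient of a volume form.
  For a metric (\<open>k = 1\<close>) it is the usual square root of the modulus of the determinant.
\<close>

definition vol :: "real^('k::finite + 'k \<Rightarrow> 'd::finite) \<Rightarrow> real" where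
  "vol T = \<bar>det (tensor_matrix T)\<bar> powr (1 / real (2 * CARD('k) * CARD('d) ^ (CARD('k) - 1)))"

context
  fixes Theta :: "real^'n::finite \<Rightarrow> real^('k::finite + 'k \<Rightarrow> 'n)"
    and F0 :: "real^'d::finite \<Rightarrow> real^('k + 'k \<Rightarrow> 'd) \<Rightarrow> real^('k + 'k \<Rightarrow> 'd) \<Rightarrow> real"
    and U :: "real^'n \<Rightarrow> real"
    and e :: "real \<Rightarrow> real"
    and x :: "real \<Rightarrow> real^'d \<Rightarrow> real^'n"
begin

definition Delta :: "real \<Rightarrow> real^'d \<Rightarrow> real^('k + 'k \<Rightarrow> 'd)" where
  "Delta t \<xi> = pullback Theta (x t) \<xi> - pullback Theta (x 0) \<xi>"

definition Delta_dot :: "real \<Rightarrow> real^'d \<Rightarrow> real^('k + 'k \<Rightarrow> 'd)" where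
  "Delta_dot t \<xi> = dt (\<lambda>s. pullback Theta (x s) \<xi>) t"

definition varpi :: "real \<Rightarrow> real^'d \<Rightarrow> real" where
  "varpi t \<xi> = vol (pullback Theta (x t) \<xi>)"

definition upsilon :: "real \<Rightarrow> real^'d \<Rightarrow> real" where
  "upsilon t \<xi> = e t * varpi t \<xi>"

definition lagrangian :: "real \<Rightarrow> real^'d \<Rightarrow> real" where
  "lagrangian t \<xi> = F0 \<xi> (Delta t \<xi>) (Delta_dot t \<xi>) + U (x t \<xi>)"

definition action :: "(real^'d) set \<Rightarrow> real" where
  "action B = integral ({0..1} \<times> B) (\<lambda>(t, \<xi>). lagrangian t \<xi> * upsilon t \<xi>)"

definition stress :: "real \<Rightarrow> real^'d \<Rightarrow> real^('k + 'k \<Rightarrow> 'd)" where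
  "stress t \<xi> = grad (\<lambda>D. F0 \<xi> D (Delta_dot t \<xi>)) (Delta t \<xi>)"

definition momentum :: "real \<Rightarrow> real^'d \<Rightarrow> real^('k + 'k \<Rightarrow> 'd)" where
  "momentum t \<xi> = grad (\<lambda>V. F0 \<xi> (Delta t \<xi>) V) (Delta_dot t \<xi>)"

definition T_hat :: "real \<Rightarrow> real^'d \<Rightarrow> real^('k + 'k \<Rightarrow> 'd) \<Rightarrow> real^('k + 'k \<Rightarrow> 'd)" where
  "T_hat t \<xi> w = (w \<bullet> Delta_dot t \<xi>) *\<^sub>R momentum t \<xi> - lagrangian t \<xi> *\<^sub>R w"

definition ln_vol_grad :: "real \<Rightarrow> real^'d \<Rightarrow> real^('k + 'k \<Rightarrow> 'd)" where
  "ln_vol_grad t \<xi> = grad (\<lambda>D. ln (vol (pullback Theta (x 0) \<xi> + D))) (Delta t \<xi>)"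

definition Sigma_tensor :: "real \<Rightarrow> real^'d \<Rightarrow> real^('k + 'k \<Rightarrow> 'd)" where
  "Sigma_tensor t \<xi> =
     stress t \<xi> - dt (\<lambda>s. momentum s \<xi>) t - T_hat t \<xi> (ln_vol_grad t \<xi>)"

text \<open>
  The same tensor with \<open>\<pi>\<close> differentiated covariantly: \<open>\<pi>\<close> is conjugate to the velocity
  \<open>d\<Theta>/dt\<close>, hence carries an upper index along the time interval, and its covariant derivative
  for the metric \<open>e dt\<close> is \<open>(1/e) d(e \<pi>)/dt = d\<pi>/dt + (e'/e) \<pi>\<close>.  It coincides with
  \<open>Sigma_tensor\<close> when \<open>e\<close> is constant.
\<close>

definition Sigma_tensor_cov :: "real \<Rightarrow> real^'d \<Rightarrow> real^('k + 'k \<Rightarrow> 'd)" where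
  "Sigma_tensor_cov t \<xi> =
     stress t \<xi> - (1 / e t) *\<^sub>R dt (\<lambda>s. e s *\<^sub>R momentum s \<xi>) t - T_hat t \<xi> (ln_vol_grad t \<xi>)"

definition Sigma_tilde ::
  "(real \<Rightarrow> real^'d \<Rightarrow> real^('k + 'k \<Rightarrow> 'd)) \<Rightarrow> 'd \<Rightarrow> 'n \<Rightarrow> real \<Rightarrow> real^'d \<Rightarrow> real" where
  "Sigma_tilde S \<alpha> A t \<xi> =
     (\<Sum>s\<in>UNIV. \<Sum>a | a s = \<alpha>. \<Sum>b | b s = A.
        S t \<xi> $ a * Theta (x t \<xi>) $ b * (\<Prod>r\<in>UNIV - {s}. pd (a r) (x t) \<xi> $ b r))"

definition divergence ::
  "(real \<Rightarrow> real^'d \<Rightarrow> real) \<Rightarrow> (real \<Rightarrow> real^'d \<Rightarrow> real^('k + 'k \<Rightarrow> 'd)) \<Rightarrow> 'n \<Rightarrow> real \<Rightarrow> real^'d \<Rightarrow> real" where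
  "divergence w S A t \<xi> =
     1 / w t \<xi> * (\<Sum>\<alpha>\<in>UNIV. pd \<alpha> (\<lambda>\<eta>. w t \<eta> * Sigma_tilde S \<alpha> A t \<eta>) \<xi>)"

definition f_Theta ::
  "(real \<Rightarrow> real^'d \<Rightarrow> real^('k + 'k \<Rightarrow> 'd)) \<Rightarrow> 'n \<Rightarrow> real \<Rightarrow> real^'d \<Rightarrow> real" where
  "f_Theta S A t \<xi> =
     - (\<Sum>a\<in>UNIV. \<Sum>b\<in>UNIV.
          S t \<xi> $ a * pd A Theta (x t \<xi>) $ b * (\<Prod>r\<in>UNIV. pd (a r) (x t) \<xi> $ b r))"

definition f_ext :: "'n \<Rightarrow> real \<Rightarrow> real^'d \<Rightarrow> real" where
  "f_ext A t \<xi> = - pd A U (x t \<xi>)"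

definition equations_of_motion ::
  "(real^'d) set \<Rightarrow> (real \<Rightarrow> real^'d \<Rightarrow> real^('k + 'k \<Rightarrow> 'd)) \<Rightarrow> bool" where
  "equations_of_motion B S \<longleftrightarrow>
     (\<forall>A. \<forall>t\<in>{0..1}. \<forall>\<xi>\<in>B. divergence upsilon S A t \<xi> + f_Theta S A t \<xi> + f_ext A t \<xi> = 0)"

end

text \<open>Variations that contribute no boundary terms, neither on the boundary of the body nor at the ends of the time interval.\<close>

definition variations :: "(real^'d::finite) set \<Rightarrow> (real \<Rightarrow> real^'d \<Rightarrow> real^'n::finite) set" where
  "variations B = {h. smooth_on (\<lambda>(t, \<xi>). h t \<xi>) UNIV \<and>
     (\<exists>K. compact K \<and> K \<subseteq> {0<..<1} \<times> interior B \<and> (\<forall>t \<xi>. (t, \<xi>) \<notin> K \<longrightarrow> h t \<xi> = 0))}"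

definition extremal ::
  "(real^'n::finite \<Rightarrow> real^('k::finite + 'k \<Rightarrow> 'n)) \<Rightarrow>
   (real^'d::finite \<Rightarrow> real^('k + 'k \<Rightarrow> 'd) \<Rightarrow> real^('k + 'k \<Rightarrow> 'd) \<Rightarrow> real) \<Rightarrow>
   (real^'n \<Rightarrow> real) \<Rightarrow> (real \<Rightarrow> real) \<Rightarrow> (real^'d) set \<Rightarrow> (real \<Rightarrow> real^'d \<Rightarrow> real^'n) \<Rightarrow> bool" where
  "extremal Theta F0 U e B x \<longleftrightarrow>
     (\<forall>h\<in>variations B.
        ((\<lambda>\<epsilon>. action Theta F0 U e (\<lambda>t \<xi>. x t \<xi> + \<epsilon> *\<^sub>R h t \<xi>) B) has_real_derivative 0) (at 0))"

end

theory Submission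
  imports Defs
begin

text \<open>
  Write \<open>\<theta>\<close> for the variation of the pullback under \<open>x \<mapsto> x + \<epsilon> h\<close>, \<open>\<pi>\<close> for the momentum and \<open>w\<close> for the
  derivative of \<open>ln \<varpi>\<close>.  Since the variation of the velocity \<open>\<partial>\<^sub>t\<Theta>\<close> is \<open>\<partial>\<^sub>t\<theta>\<close> and
  \<open>\<partial>\<^sub>t\<varpi> = \<varpi> \<langle>w, \<partial>\<^sub>t\<Theta>\<rangle>\<close>, the derivative in \<open>\<epsilon>\<close> of the action density is
  \<open>\<upsilon> (\<langle>\<Sigma>, \<theta>\<rangle> + dU(h)) + \<partial>\<^sub>t (\<upsilon> \<langle>\<pi>, \<theta>\<rangle>)\<close>, with \<open>\<Sigma>\<close> the covariant form of the stress tensor.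
  Expanding \<open>\<theta>\<close> by the product rule, it becomes minus \<open>\<upsilon>\<close> times the equations of motion contracted
  with \<open>h\<close>, up to the divergence of a field with compact support, whose integral vanishes because
  integrals are invariant under translations.
\<close>


subsection \<open>Smooth functions\<close>

text \<open>The data are smooth only near [0,1] x B, and the integrand only where the history lies
  in \<open>M\<close> and the pullback is nondegenerate. These conditions are open, so they hold on
  an open set around that compact product and, for small \<epsilon>, uniformly over it. The
  definitions differentiate along slices (\<open>dt\<close>, \<open>pd\<close>), while the variation
  needs smoothness jointly in \<epsilon>, t and \<xi>; hence the pullback becomes a function on the
  whole parameter space and each derivative a directional one. The covariant form is forced by
  integration by parts in time: the weight is \<open>e\<close> times the volume density, so the
  derivative falls on that density and on e \<pi>. The first gives the term of \<open>T_hat\<close>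
  with \<pi>; the second, divided by \<open>e\<close>, is the covariant derivative of \<pi>. The
  other term of \<open>T_hat\<close> comes from varying the volume. The boundary of B may be
  irregular, so boundary integrals are avoided: test fields are supported inside, which also leaves
  the initial configuration in \<open>Delta\<close> unvaried.\<close>

abbreviation (input) dd :: "'a::real_normed_vector \<Rightarrow> ('a \<Rightarrow> 'b::real_normed_vector) \<Rightarrow> 'a \<Rightarrow> 'b"
  where "dd v f \<equiv> \<lambda>p. frechet_derivative f (at p) v"

lemma dd_eqI: "(f has_derivative f') (at p) \<Longrightarrow> dd v f p = f' v"
  using frechet_derivative_at by metis

lemma dd_transform:
  assumes "open S" "p \<in> S" "\<And>x. x \<in> S \<Longrightarrow> f x = g x"
  shows "dd v f p = dd v g p"
proof -
  have "(f has_derivative f') (at p) \<longleftrightarrow> (g has_derivative f') (at p)" for f'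
    using has_derivative_transform_within_open[OF _ assms(1,2)] assms(3) by metis
  then show ?thesis by (simp add: frechet_derivative_def)
qed

text \<open>Openness matters because a derivative sees a whole neighbourhood. This is how smoothness
  is shown for derivatives that are known only by a formula on S.\<close>

lemma Ck_on_cong:
  assumes "open S" "\<And>x. x \<in> S \<Longrightarrow> f x = g x"
  shows "Ck_on r f S \<longleftrightarrow> Ck_on r g S"
  using assms(2)
proof (induction r arbitrary: f g)
  case 0
  then show ?case by (simp cong: continuous_on_cong)
next
  case (Suc r)
  have "f differentiable (at x) \<longleftrightarrow> g differentiable (at x)" if "x \<in> S" for x
    using Suc.prems has_derivative_transform_within_open[OF _ assms(1) that]
    unfolding differentiable_def by metis
  moreover have "Ck_on r (dd v f) S \<longleftrightarrow> Ck_on r (dd v g) S" for v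
    by (rule Suc.IH) (rule dd_transform[OF assms(1)], auto simp: Suc.prems)
  ultimately show ?case by simp
qed

lemma Ck_on_Suc_imp: "Ck_on (Suc r) f S \<Longrightarrow> Ck_on r f S"
proof (induction r arbitrary: f)
  case 0
  then have "\<forall>x\<in>S. isCont f x"
    by (auto intro: differentiable_imp_continuous_within)
  then show ?case by (simp add: continuous_at_imp_continuous_on)
next
  case (Suc r)
  then show ?case by (metis Ck_on.simps(2))
qed

lemma Ck_on_subset: "Ck_on r f S \<Longrightarrow> T \<subseteq> S \<Longrightarrow> Ck_on r f T"
  by (induction r arbitrary: f) (auto intro: continuous_on_subset)

lemma Ck_on_const: "Ck_on r (\<lambda>x. c) S"
  by (induction r arbitrary: c) auto

lemma Ck_on_bounded_linear:
  assumes "bounded_linear L" "open S" "Ck_on r f S"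
  shows "Ck_on r (\<lambda>x. L (f x)) S"
  using assms(3)
proof (induction r arbitrary: f)
  case 0
  then show ?case using bounded_linear.continuous_on[OF assms(1)] by auto
next
  case (Suc r)
  have D: "((\<lambda>x. L (f x)) has_derivative (\<lambda>v. L (dd v f x))) (at x)" if "x \<in> S" for x
    using Suc.prems that bounded_linear.has_derivative[OF assms(1)]
    by (auto simp: frechet_derivative_works)
  have "Ck_on r (dd v (\<lambda>x. L (f x))) S" for v
    by (subst Ck_on_cong[OF assms(2) dd_eqI[OF D]]) (use Suc in auto)
  then show ?case using D by (auto simp: differentiable_def)
qed

lemma Ck_on_add:
  assumes "open S" "Ck_on r f S" "Ck_on r g S"
  shows "Ck_on r (\<lambda>x. f x + g x) S"
  using assms(2,3)
proof (induction r arbitrary: f g)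
  case 0
  then show ?case by (auto intro: continuous_intros)
next
  case (Suc r)
  have D: "((\<lambda>x. f x + g x) has_derivative (\<lambda>v. dd v f x + dd v g x)) (at x)" if "x \<in> S" for x
    using Suc.prems that has_derivative_add by (auto simp: frechet_derivative_works)
  have "Ck_on r (dd v (\<lambda>x. f x + g x)) S" for v
    by (subst Ck_on_cong[OF assms(1) dd_eqI[OF D]]) (use Suc in auto)
  then show ?case using D by (auto simp: differentiable_def)
qed

lemma Ck_on_sum:
  assumes "open S" "\<And>i. i \<in> I \<Longrightarrow> Ck_on r (f i) S"
  shows "Ck_on r (\<lambda>x. \<Sum>i\<in>I. f i x) S"
  using assms(2)
  by (induction I rule: infinite_finite_induct) (auto intro: Ck_on_const Ck_on_add[OF assms(1)])

lemma Ck_on_bilinear: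
  assumes "bounded_bilinear m" "open S" "Ck_on r f S" "Ck_on r g S"
  shows "Ck_on r (\<lambda>x. m (f x) (g x)) S"
  using assms(3,4)
proof (induction r arbitrary: f g)
  case 0
  then show ?case using bounded_bilinear.continuous_on[OF assms(1)] by auto
next
  case (Suc r)
  have D: "((\<lambda>x. m (f x) (g x)) has_derivative (\<lambda>v. m (f x) (dd v g x) + m (dd v f x) (g x))) (at x)"
    if "x \<in> S" for x
    by (rule bounded_bilinear.FDERIV[OF assms(1)])
       (use Suc.prems that in \<open>auto simp flip: frechet_derivative_works\<close>)
  \<comment> \<open>Each term of the product rule keeps one undifferentiated factor, which is
    lowered by one order before the induction hypothesis applies.\<close>
  have "Ck_on r (dd v (\<lambda>x. m (f x) (g x))) S" for v
    by (subst Ck_on_cong[OF assms(2) dd_eqI[OF D]], assumption)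
       (use Suc.prems Suc.prems[THEN Ck_on_Suc_imp] in
         \<open>intro Ck_on_add[OF assms(2)] Suc.IH; simp\<close>)
  then show ?case using D by (auto simp: differentiable_def)
qed

lemma linear_basis_expansion:
  fixes f :: "'a::euclidean_space \<Rightarrow> 'b::real_normed_vector"
  assumes "linear f"
  shows "f v = (\<Sum>b\<in>Basis. (v \<bullet> b) *\<^sub>R f b)"
proof -
  have "f v = f (\<Sum>b\<in>Basis. (v \<bullet> b) *\<^sub>R b)" by (simp add: euclidean_representation)
  then show ?thesis using assms by (simp add: linear_sum linear_cmul)
qed

text \<open>The chain rule differentiates f in the direction \<open>dd v g x\<close>, which moves
  with x, while \<open>Ck_on\<close> controls fixed directions only. Expanding the moving direction
  in a basis of the intermediate space turns its coordinates into coefficients of class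
  \<open>Ck_on r\<close>.\<close>

lemma Ck_on_compose:
  fixes f :: "'b::euclidean_space \<Rightarrow> 'c::real_normed_vector"
  assumes "open S" "open T" "g ` S \<subseteq> T" "Ck_on r f T" "Ck_on r g S"
  shows "Ck_on r (\<lambda>x. f (g x)) S"
  using assms(4,5)
proof (induction r arbitrary: f)
  case 0
  then show ?case using assms(3) by (auto intro: continuous_on_compose2)
next
  case (Suc r)
  have D: "((\<lambda>x. f (g x)) has_derivative (\<lambda>v. dd (dd v g x) f (g x))) (at x)" if "x \<in> S" for x
    using Suc.prems that assms(3) has_derivative_compose[of g _ x UNIV f]
    by (auto simp: frechet_derivative_works image_subset_iff)
  have E: "dd v (\<lambda>x. f (g x)) x = (\<Sum>b\<in>Basis. (dd v g x \<bullet> b) *\<^sub>R dd b f (g x))" if "x \<in> S" for x v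
  proof -
    have "f differentiable (at (g x))" using Suc.prems that assms(3) by auto
    then show ?thesis
      unfolding dd_eqI[OF D[OF that]] by (intro linear_basis_expansion linear_frechet_derivative)
  qed
  have "Ck_on r (\<lambda>x. (dd v g x \<bullet> b) *\<^sub>R dd b f (g x)) S" for v b
  proof (rule Ck_on_bilinear[OF bounded_bilinear_scaleR assms(1)])
    show "Ck_on r (\<lambda>x. dd v g x \<bullet> b) S"
      using Suc.prems by (intro Ck_on_bounded_linear[OF bounded_linear_inner_left assms(1)]) simp
    show "Ck_on r (\<lambda>x. dd b f (g x)) S"
      using Suc.prems Ck_on_Suc_imp[of r g S] by (intro Suc.IH) auto
  qed
  then have "Ck_on r (dd v (\<lambda>x. f (g x))) S" for v
    by (subst Ck_on_cong[OF assms(1) E]) (auto intro: Ck_on_sum[OF assms(1)])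
  then show ?case using D by (auto simp: differentiable_def)
qed

lemma smooth_on_cong: "open S \<Longrightarrow> (\<And>x. x \<in> S \<Longrightarrow> f x = g x) \<Longrightarrow> smooth_on f S \<longleftrightarrow> smooth_on g S"
  unfolding smooth_on_def using Ck_on_cong by metis

lemma smooth_on_subset: "smooth_on f S \<Longrightarrow> T \<subseteq> S \<Longrightarrow> smooth_on f T"
  unfolding smooth_on_def using Ck_on_subset by metis

lemma smooth_on_differentiable: "smooth_on f S \<Longrightarrow> p \<in> S \<Longrightarrow> f differentiable (at p)"
  unfolding smooth_on_def by (metis Ck_on.simps(2))

lemma smooth_on_has_derivative:
  "smooth_on f S \<Longrightarrow> p \<in> S \<Longrightarrow> (f has_derivative (\<lambda>v. dd v f p)) (at p)"
  using smooth_on_differentiable frechet_derivative_works by metis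

lemma smooth_on_continuous: "smooth_on f S \<Longrightarrow> continuous_on S f"
  unfolding smooth_on_def by (metis Ck_on.simps(1))

lemma smooth_on_dd: "smooth_on f S \<Longrightarrow> smooth_on (dd v f) S"
  unfolding smooth_on_def by (metis Ck_on.simps(2))

lemma smooth_on_const: "smooth_on (\<lambda>x. c) S"
  by (simp add: smooth_on_def Ck_on_const)

lemma smooth_on_bounded_linear:
  "bounded_linear L \<Longrightarrow> open S \<Longrightarrow> smooth_on f S \<Longrightarrow> smooth_on (\<lambda>x. L (f x)) S"
  unfolding smooth_on_def using Ck_on_bounded_linear[of L S _ f] by blast

lemma smooth_on_ident: "open S \<Longrightarrow> smooth_on (\<lambda>x. x) S"
proof -
  assume "open S"
  have "Ck_on r (\<lambda>x. x) S" for r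
  proof (cases r)
    case 0
    then show ?thesis by (simp add: continuous_on_id)
  qed (auto intro: Ck_on_const)
  then show ?thesis by (simp add: smooth_on_def)
qed

lemma smooth_on_add: "open S \<Longrightarrow> smooth_on f S \<Longrightarrow> smooth_on g S \<Longrightarrow> smooth_on (\<lambda>x. f x + g x) S"
  unfolding smooth_on_def using Ck_on_add[of S _ f g] by blast

lemma smooth_on_sum:
  "open S \<Longrightarrow> (\<And>i. i \<in> I \<Longrightarrow> smooth_on (f i) S) \<Longrightarrow> smooth_on (\<lambda>x. \<Sum>i\<in>I. f i x) S"
  unfolding smooth_on_def using Ck_on_sum[of S I _ f] by blast

lemma smooth_on_bilinear:
  "bounded_bilinear m \<Longrightarrow> open S \<Longrightarrow> smooth_on f S \<Longrightarrow> smooth_on g S \<Longrightarrow> smooth_on (\<lambda>x. m (f x) (g x)) S"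
  unfolding smooth_on_def using Ck_on_bilinear[of m S _ f g] by blast

lemma smooth_on_compose:
  fixes f :: "'b::euclidean_space \<Rightarrow> 'c::real_normed_vector"
  shows "smooth_on f T \<Longrightarrow> open T \<Longrightarrow> open S \<Longrightarrow> smooth_on g S \<Longrightarrow> g ` S \<subseteq> T \<Longrightarrow> smooth_on (\<lambda>x. f (g x)) S"
  unfolding smooth_on_def using Ck_on_compose[of S T g _ f] by blast

lemmas smooth_on_mult = smooth_on_bilinear[OF bounded_bilinear_mult]
lemmas smooth_on_scaleR = smooth_on_bilinear[OF bounded_bilinear_scaleR]
lemmas smooth_on_inner = smooth_on_bilinear[OF bounded_bilinear_inner]
lemmas smooth_on_fst = smooth_on_bounded_linear[OF bounded_linear_fst]
lemmas smooth_on_snd = smooth_on_bounded_linear[OF bounded_linear_snd]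
lemmas smooth_on_vec_nth = smooth_on_bounded_linear[OF bounded_linear_vec_nth]

lemma smooth_on_minus: "open S \<Longrightarrow> smooth_on f S \<Longrightarrow> smooth_on (\<lambda>x. - f x) S"
  by (rule smooth_on_bounded_linear[OF bounded_linear_minus[OF bounded_linear_ident]])

lemma smooth_on_diff: "open S \<Longrightarrow> smooth_on f S \<Longrightarrow> smooth_on g S \<Longrightarrow> smooth_on (\<lambda>x. f x - g x) S"
  using smooth_on_add[of S f "\<lambda>x. - g x"] smooth_on_minus[of S g] by simp

lemma smooth_on_prod:
  fixes f :: "'i \<Rightarrow> 'a::real_normed_vector \<Rightarrow> real"
  assumes "open S" "\<And>i. i \<in> I \<Longrightarrow> smooth_on (f i) S"
  shows "smooth_on (\<lambda>x. \<Prod>i\<in>I. f i x) S"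
  using assms(2)
  by (induction I rule: infinite_finite_induct) (auto intro: smooth_on_const smooth_on_mult[OF assms(1)])

lemma smooth_on_Pair:
  assumes "open S" "smooth_on f S" "smooth_on g S"
  shows "smooth_on (\<lambda>x. (f x, g x)) S"
proof -
  have "smooth_on (\<lambda>x. (f x, 0) + (0, g x)) S"
    by (intro smooth_on_add[OF assms(1)] smooth_on_bounded_linear[OF _ assms(1,2)]
          smooth_on_bounded_linear[OF _ assms(1,3)] bounded_linear_Pair
          bounded_linear_ident bounded_linear_zero)
  then show ?thesis by simp
qed

lemma vec_eq_sum_axis: "(\<chi> i. f i) = (\<Sum>i\<in>UNIV. f i *\<^sub>R (axis i 1 :: real^'i::finite))"
  by (simp add: vec_eq_iff axis_def if_distrib cong: if_cong)

lemma smooth_on_vec: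
  assumes "open S" "\<And>i. smooth_on (\<lambda>x. f x i) S"
  shows "smooth_on (\<lambda>x. (\<chi> i. f x i) :: real^'i::finite) S"
  unfolding vec_eq_sum_axis
  by (intro smooth_on_sum smooth_on_bounded_linear[OF bounded_linear_scaleR_left] assms)

text \<open>The derivative is a constant times the power with exponent \<open>c - 1\<close>, so the
  induction runs over all exponents at once.\<close>

lemma Ck_on_powr: "Ck_on r (\<lambda>y::real. y powr c) {0<..}"
proof (induction r arbitrary: c)
  case 0
  then show ?case by (auto intro!: continuous_intros)
next
  case (Suc r)
  have D: "((\<lambda>y. y powr c) has_derivative (\<lambda>v. (c * v) * y powr (c - 1))) (at y)" if "y > 0" for y
    using has_real_derivative_powr[OF that, of c]
    by (auto simp: has_field_derivative_def mult_ac elim!: has_derivative_eq_rhs)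
  have "Ck_on r (dd v (\<lambda>y. y powr c)) {0<..}" for v
    by (subst Ck_on_cong[OF _ dd_eqI[OF D]])
       (auto intro!: Ck_on_bounded_linear[OF bounded_linear_mult_right] Suc)
  then show ?case using D by (auto simp: differentiable_def)
qed

lemma smooth_on_powr:
  fixes f :: "'a::real_normed_vector \<Rightarrow> real"
  assumes "open S" "smooth_on f S" "\<And>p. p \<in> S \<Longrightarrow> f p > 0"
  shows "smooth_on (\<lambda>p. f p powr c) S"
  by (rule smooth_on_compose[of "\<lambda>y::real. y powr c" "{0<..}"])
     (use assms in \<open>auto simp: smooth_on_def Ck_on_powr\<close>)

text \<open>The modulus is removed by squaring: the function is the power \<open>c / 2\<close> of
  \<open>f p * f p\<close>, which is positive whatever the sign of f. It serves \<open>vol\<close>,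
  a power of the modulus of a determinant.\<close>

lemma smooth_on_abs_powr:
  fixes f :: "'a::real_normed_vector \<Rightarrow> real"
  assumes "open S" "smooth_on f S" "\<And>p. p \<in> S \<Longrightarrow> f p \<noteq> 0"
  shows "smooth_on (\<lambda>p. \<bar>f p\<bar> powr c) S"
proof -
  have "\<bar>y\<bar> powr c = (y * y) powr (c / 2)" if "y \<noteq> 0" for y :: real
    using that powr_powr[of "\<bar>y\<bar>" 2 "c / 2"] by (simp add: power2_eq_square)
  then have "smooth_on (\<lambda>p. \<bar>f p\<bar> powr c) S \<longleftrightarrow> smooth_on (\<lambda>p. (f p * f p) powr (c / 2)) S"
    using assms by (intro smooth_on_cong) auto
  then show ?thesis
    using assms by (auto intro!: smooth_on_powr smooth_on_mult simp: zero_less_mult_iff)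
qed

subsection \<open>Integrals of derivatives\<close>

text \<open>The bridge from Frechet derivatives to calculus in one variable, by restriction to a
  line.\<close>

lemma dd_vector_derivative:
  assumes "smooth_on f S" "p + s *\<^sub>R u \<in> S"
  shows "((\<lambda>s. f (p + s *\<^sub>R u)) has_vector_derivative dd u f (p + s *\<^sub>R u)) (at s)"
proof -
  let ?f' = "frechet_derivative f (at (p + s *\<^sub>R u))"
  have "((\<lambda>s. f (p + s *\<^sub>R u)) has_derivative (\<lambda>r. ?f' (r *\<^sub>R u))) (at s)"
    using smooth_on_has_derivative[OF assms]
    by (intro has_derivative_compose[of "\<lambda>s. p + s *\<^sub>R u" "\<lambda>r. r *\<^sub>R u" s UNIV f ?f'])
       (auto intro!: derivative_eq_intros)
  moreover have "linear ?f'"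
    using linear_frechet_derivative smooth_on_differentiable[OF assms] by blast
  ultimately show ?thesis by (simp add: has_vector_derivative_def linear_cmul)
qed

text \<open>Smoothness on open sets is local. This glues a function to its extension by
  zero.\<close>

lemma smooth_on_Un:
  assumes "open S" "open T" "smooth_on f S" "smooth_on f T"
  shows "smooth_on f (S \<union> T)"
proof -
  have "Ck_on r f S \<Longrightarrow> Ck_on r f T \<Longrightarrow> Ck_on r f (S \<union> T)" for r
    by (induction r arbitrary: f) (auto intro: continuous_on_open_Un assms(1,2))
  then show ?thesis using assms by (auto simp: smooth_on_def)
qed

lemma continuous_on_compact_integrable:
  fixes f :: "'a::euclidean_space \<Rightarrow> real"
  assumes "compact Z" "continuous_on Z f"
  shows "f integrable_on Z"
  using set_borel_integral_eq_integral(1)[of Z f] borel_integrable_compact[OF assms]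
  by (simp add: set_integrable_def)

text \<open>Differentiation under the integral sign. The derivative in s is uniformly continuous on
  a compact product, so the error of the linear approximation is small uniformly over Z and may be
  integrated.\<close>

lemma has_real_derivative_integral_compact:
  fixes F :: "real \<times> 'a::euclidean_space \<Rightarrow> real"
  assumes Z: "compact Z" "open S" "{0} \<times> Z \<subseteq> S" and F: "smooth_on F S"
  shows "((\<lambda>s. integral Z (\<lambda>p. F (s, p))) has_real_derivative
           integral Z (\<lambda>p. dd (1, 0) F (0, p))) (at 0)"
proof -
  let ?F' = "dd (1, 0) F"
  \<comment> \<open>Compactness of Z yields one interval of s that works for all points of
    Z.\<close>
  obtain X where X: "0 \<in> X" "open X" "X \<times> Z \<subseteq> S" using Elementary_Topology.tube_lemma[OF Z] by blast
  then obtain \<delta> where \<delta>: "\<delta> > 0" "cball 0 \<delta> \<subseteq> X" using open_contains_cball_eq by metis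
  have sub: "cball 0 \<delta> \<times> Z \<subseteq> S" using \<delta> X by blast
  have D: "((\<lambda>s. F (s, p)) has_real_derivative ?F' (s, p)) (at s)" if "s \<in> cball 0 \<delta>" "p \<in> Z" for s p
    using dd_vector_derivative[OF F, of "(0, p)" s "(1, 0)"] that sub
    by (auto simp: has_real_derivative_iff_has_vector_derivative dest!: subsetD[of _ S "(s, p)"])
  have contF: "continuous_on (cball 0 \<delta> \<times> Z) F" and contF': "continuous_on (cball 0 \<delta> \<times> Z) ?F'"
    using F smooth_on_dd[OF F] sub by (blast intro: continuous_on_subset smooth_on_continuous)+
  have intF: "(\<lambda>p. F (s, p)) integrable_on Z" if "s \<in> cball 0 \<delta>" for s
    using that Z(1) by (intro continuous_on_compact_integrable continuous_on_compose2[OF contF])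
      (auto intro!: continuous_intros)
  have intF': "(\<lambda>p. ?F' (0, p)) integrable_on Z"
    using \<delta> Z(1) by (intro continuous_on_compact_integrable continuous_on_compose2[OF contF'])
      (auto intro!: continuous_intros)
  have "uniformly_continuous_on (cball 0 \<delta> \<times> Z) ?F'"
    using contF' Z(1) by (intro compact_uniformly_continuous compact_Times) auto
  note unif = this[unfolded uniformly_continuous_on_def, rule_format]
  define C where "C = integral Z (\<lambda>_. 1 :: real)"
  have int1: "(\<lambda>_. c :: real) integrable_on Z" for c
    using Z(1) by (intro continuous_on_compact_integrable continuous_intros)
  have "C \<ge> 0" unfolding C_def by (intro integral_nonneg int1) auto
  have "\<exists>d>0. \<forall>s. \<bar>s\<bar> < d \<longrightarrow> \<bar>integral Z (\<lambda>p. F (s, p)) - integral Z (\<lambda>p. F (0, p))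
          - integral Z (\<lambda>p. ?F' (0, p)) * s\<bar> \<le> \<epsilon> * \<bar>s\<bar>" if "\<epsilon> > 0" for \<epsilon>
  proof -
    \<comment> \<open>\<open>C\<close> is the volume of Z and may be zero, hence the summand
      1.\<close>
    define \<eta> where "\<eta> = \<epsilon> / (C + 1)"
    have "\<eta> > 0" "\<eta> * C \<le> \<epsilon>" using that \<open>C \<ge> 0\<close> by (auto simp: \<eta>_def field_simps)
    obtain d where d: "d > 0" "\<And>x x'. x \<in> cball 0 \<delta> \<times> Z \<Longrightarrow> x' \<in> cball 0 \<delta> \<times> Z \<Longrightarrow>
        dist x' x < d \<Longrightarrow> dist (?F' x') (?F' x) < \<eta>"
      using unif[OF \<open>\<eta> > 0\<close>] by metis
    show ?thesis
    proof (intro exI[of _ "min d \<delta>"] conjI allI impI)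
      fix s assume s: "\<bar>s\<bar> < min d \<delta>"
      have bound: "\<bar>F (s, p) - F (0, p) - ?F' (0, p) * s\<bar> \<le> \<eta> * \<bar>s\<bar>" if p: "p \<in> Z" for p
      proof -
        \<comment> \<open>The mean value estimate is applied after subtracting the linear part, so
          that only the oscillation of the derivative is left to bound.\<close>
        have "norm ((F (s, p) - ?F' (0, p) * s) - (F (0, p) - ?F' (0, p) * 0)) \<le> \<eta> * norm (s - 0)"
        proof (rule field_differentiable_bound[of "cball 0 \<bar>s\<bar>" _ "\<lambda>r. ?F' (r, p) - ?F' (0, p)"])
          fix r :: real assume r: "r \<in> cball 0 \<bar>s\<bar>"
          show "((\<lambda>r. F (r, p) - ?F' (0, p) * r) has_field_derivative ?F' (r, p) - ?F' (0, p))
                  (at r within cball 0 \<bar>s\<bar>)"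
            by (rule has_field_derivative_at_within)
               (use r s p in \<open>auto intro!: derivative_eq_intros D\<close>)
          show "norm (?F' (r, p) - ?F' (0, p)) \<le> \<eta>"
            using d(2)[of "(0, p)" "(r, p)"] r s p \<delta>(1)
            by (auto simp: dist_Pair_Pair dist_norm intro: less_imp_le)
        qed auto
        then show ?thesis by (simp add: algebra_simps)
      qed
      have s\<delta>: "s \<in> cball 0 \<delta>" using s by auto
      have "norm (integral Z (\<lambda>p. F (s, p) - F (0, p) - ?F' (0, p) * s)) \<le> integral Z (\<lambda>_. \<eta> * \<bar>s\<bar>)"
        using bound s\<delta> \<delta>(1)
        by (intro integral_norm_bound_integral int1 integrable_diff intF integrable_on_mult_left intF') auto
      also have "integral Z (\<lambda>p. F (s, p) - F (0, p) - ?F' (0, p) * s) =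
          integral Z (\<lambda>p. F (s, p)) - integral Z (\<lambda>p. F (0, p)) - integral Z (\<lambda>p. ?F' (0, p)) * s"
        using s\<delta> \<delta>(1) by (simp add: integral_diff integrable_diff intF integrable_on_mult_left intF')
      also have "integral Z (\<lambda>_. \<eta> * \<bar>s\<bar>) = \<eta> * \<bar>s\<bar> * C"
        using integral_mult_right[of Z "\<eta> * \<bar>s\<bar>" "\<lambda>_. 1"] by (simp add: C_def)
      also have "\<eta> * \<bar>s\<bar> * C \<le> \<epsilon> * \<bar>s\<bar>"
        using \<open>\<eta> * C \<le> \<epsilon>\<close> mult_right_mono[of "\<eta> * C" \<epsilon> "\<bar>s\<bar>"] by (simp add: mult_ac)
      finally show "\<bar>integral Z (\<lambda>p. F (s, p)) - integral Z (\<lambda>p. F (0, p))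
          - integral Z (\<lambda>p. ?F' (0, p)) * s\<bar> \<le> \<epsilon> * \<bar>s\<bar>" by simp
    qed (use d \<delta> in auto)
  qed
  then show ?thesis
    by (simp add: has_field_derivative_def has_derivative_at_alt bounded_linear_mult_right)
qed

lemma integral_eq_integral_UNIV:
  fixes f :: "'a::euclidean_space \<Rightarrow> real"
  assumes "\<And>p. p \<notin> S \<Longrightarrow> f p = 0"
  shows "integral S f = integral UNIV f"
proof -
  have "(\<lambda>p. if p \<in> S then f p else 0) = f" using assms by auto
  then show ?thesis using integral_restrict_UNIV[of S f] by simp
qed

lemma integral_dd_eq_0_UNIV:
  fixes g :: "'a::euclidean_space \<Rightarrow> real"
  assumes g: "smooth_on g UNIV" and K: "compact K" "\<And>p. p \<notin> K \<Longrightarrow> g p = 0"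
  shows "integral UNIV (dd v g) = 0"
proof -
  obtain R where R: "K \<subseteq> cball 0 R"
    using compact_imp_bounded[OF K(1)] by (auto simp: bounded_iff subset_iff)
  \<comment> \<open>The radius makes Z contain the support of every translate by
    \<open>s *\<^sub>R v\<close> with \<bar>s\<bar> < 1, so the domain of integration stays fixed
    while s moves.\<close>
  define Z where "Z = cball (0::'a) (R + norm v)"
  \<comment> \<open>The integral of \<open>g (p + s v)\<close> does not depend on \<open>s\<close>; differentiate at \<open>s = 0\<close>.\<close>
  have shift: "integral UNIV (\<lambda>p. g (p + c)) = integral UNIV g" for c
  proof -
    obtain a b where ab: "K \<subseteq> cbox a b"
      using bounded_subset_cbox_symmetric[OF compact_imp_bounded[OF K(1)]] by blast
    have "integral UNIV (\<lambda>p. g (p + c)) = integral (cbox (a - c) (b - c)) (\<lambda>p. g (p + c))"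
    proof (rule integral_eq_integral_UNIV[symmetric])
      fix p assume "p \<notin> cbox (a - c) (b - c)"
      then have "p + c \<notin> cbox a b" by (auto simp: mem_box algebra_simps)
      then show "g (p + c) = 0" using ab K(2) by blast
    qed
    also have "\<dots> = integral (cbox a b) g" by (rule integral_shift_cbox)
    also have "\<dots> = integral UNIV g" using ab K(2) by (intro integral_eq_integral_UNIV) blast
    finally show ?thesis .
  qed
  define F where "F = (\<lambda>q::real \<times> 'a. g (snd q + fst q *\<^sub>R v))"
  have F: "smooth_on F UNIV"
    unfolding F_def
    by (rule smooth_on_compose[OF g])
       (auto intro!: smooth_on_add smooth_on_scaleR smooth_on_fst smooth_on_snd smooth_on_ident
          smooth_on_const)
  have F': "dd (1, 0) F (0, p) = dd v g p" for p
  proof -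
    have "((\<lambda>s. F (s, p)) has_vector_derivative dd (1, 0) F (0, p)) (at 0)"
      using dd_vector_derivative[OF F, of "(0, p)" 0 "(1, 0)"] by simp
    moreover have "((\<lambda>s. F (s, p)) has_vector_derivative dd v g p) (at 0)"
      using dd_vector_derivative[OF g, of p 0 v] by (simp add: F_def)
    ultimately show ?thesis by (rule vector_derivative_unique_at)
  qed
  have "((\<lambda>s. integral Z (\<lambda>p. F (s, p))) has_real_derivative integral Z (dd v g)) (at 0)"
    using has_real_derivative_integral_compact[OF _ open_UNIV _ F, of Z] by (simp add: F' Z_def)
  moreover have "((\<lambda>s. integral Z (\<lambda>p. F (s, p))) has_real_derivative 0) (at 0)"
  proof (rule has_field_derivative_transform_within_open[of "\<lambda>_. integral UNIV g" _ _ "ball 0 1"])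
    fix s :: real assume "s \<in> ball 0 1"
    then have s: "\<bar>s\<bar> < 1" by auto
    have "integral Z (\<lambda>p. F (s, p)) = integral UNIV (\<lambda>p. g (p + s *\<^sub>R v))"
      unfolding F_def fst_conv snd_conv
    proof (rule integral_eq_integral_UNIV)
      fix p assume "p \<notin> Z"
      then have "norm p > R + norm v" by (simp add: Z_def)
      moreover have "norm (s *\<^sub>R v) \<le> norm v" using s by (simp add: mult_left_le_one_le)
      moreover have "norm p \<le> norm (p + s *\<^sub>R v) + norm (s *\<^sub>R v)"
        using norm_triangle_ineq4[of "p + s *\<^sub>R v" "s *\<^sub>R v"] by simp
      ultimately have "norm (p + s *\<^sub>R v) > R" by linarith
      then show "g (p + s *\<^sub>R v) = 0" using K(2) R by force
    qed
    then show "integral UNIV g = integral Z (\<lambda>p. F (s, p))" using shift by simp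
  qed auto
  ultimately have "integral Z (dd v g) = 0" by (rule DERIV_unique)
  moreover have "integral Z (dd v g) = integral UNIV (dd v g)"
  proof (rule integral_eq_integral_UNIV)
    fix p assume "p \<notin> Z"
    have "norm p \<le> R" if "p \<in> K" using that R by auto
    then have "p \<in> - K" using \<open>p \<notin> Z\<close> norm_ge_zero[of v] unfolding Z_def by fastforce
    then have "dd v g p = dd v (\<lambda>_. 0) p"
      using K by (intro dd_transform[of "- K"]) (auto simp: compact_imp_closed)
    then show "dd v g p = 0" by simp
  qed
  ultimately show ?thesis by simp
qed

text \<open>Extension by zero reduces this to the whole space: g vanishes on \<open>W - K\<close>,
  and the open sets \<open>W\<close> and \<open>- K\<close> cover everything because K lies in
  \<open>W\<close>.\<close>

lemma integral_dd_eq_0: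
  fixes g :: "'a::euclidean_space \<Rightarrow> real"
  assumes W: "open W" "Z \<subseteq> W" and g: "smooth_on g W"
    and K: "compact K" "K \<subseteq> Z" "\<And>p. p \<in> W - K \<Longrightarrow> g p = 0"
  shows "integral Z (dd v g) = 0"
proof -
  define g' where "g' p = (if p \<in> W then g p else 0)" for p
  have K': "open (- K)" using K(1) by (simp add: compact_imp_closed open_Compl)
  have off: "g' p = 0" if "p \<in> - K" for p using that K(3) by (auto simp: g'_def)
  have "smooth_on g' W \<longleftrightarrow> smooth_on g W" by (rule smooth_on_cong[OF W(1)]) (simp add: g'_def)
  moreover have "smooth_on g' (- K) \<longleftrightarrow> smooth_on (\<lambda>_. 0::real) (- K)"
    by (rule smooth_on_cong[OF K']) (rule off)
  ultimately have "smooth_on g' (W \<union> - K)"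
    using g smooth_on_const by (intro smooth_on_Un[OF W(1) K']) auto
  moreover have "W \<union> - K = UNIV" using K(2) W(2) by auto
  ultimately have "integral UNIV (dd v g') = 0"
    using off by (intro integral_dd_eq_0_UNIV[OF _ K(1)]) auto
  moreover have "integral Z (dd v g) = integral Z (dd v g')"
    by (rule integral_cong, rule dd_transform[OF W(1)]) (use W(2) g'_def in auto)
  moreover have "integral Z (dd v g') = integral UNIV (dd v g')"
  proof (rule integral_eq_integral_UNIV)
    fix p assume "p \<notin> Z"
    then have "dd v g' p = dd v (\<lambda>_. 0) p"
      using K(2) off by (intro dd_transform[OF K']) auto
    then show "dd v g' p = 0" by simp
  qed
  ultimately show ?thesis by simp
qed

section \<open>Symmetry of second derivatives\<close>

lemma dd_commute_real:
  fixes f :: "'a::euclidean_space \<Rightarrow> real"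
  assumes S: "open S" "p \<in> S" and f: "smooth_on f S"
  shows "dd u (dd v f) p = dd v (dd u f) p"
proof -
  note f' = smooth_on_dd[OF f] and f'' = smooth_on_dd[OF smooth_on_dd[OF f]]
  define w where "w y = p + y *\<^sub>R v" for y
  have "open (w -` S)" "0 \<in> w -` S"
    using S by (auto simp: w_def intro!: open_vimage continuous_intros)
  then obtain r where r: "r > 0" "cball 0 r \<subseteq> w -` S" using open_contains_cball_eq by metis
  have wS: "w y \<in> S" if "y \<in> {0..r}" for y using that subsetD[OF r(2), of y] by auto
  have contw: "continuous_on {0..b} (\<lambda>y. h (w y))" if "b \<le> r" "smooth_on h S" for h :: "'a \<Rightarrow> real" and b
    using that wS by (intro continuous_on_compose2[OF smooth_on_continuous[OF that(2)]])
      (auto simp: w_def intro!: continuous_intros)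
  \<comment> \<open>Differentiate \<open>\<integral> \<partial>\<^sub>v f (p + s u + y v) dy\<close> in \<open>s\<close>, under the integral and after integrating.\<close>
  have mixed: "integral {0..b} (\<lambda>y. dd u (dd v f) (w y)) = dd u f (w b) - dd u f p" if b: "b \<in> {0..r}" for b
  proof -
    define A where "A = (\<lambda>q::real \<times> real. p + fst q *\<^sub>R u + snd q *\<^sub>R v)"
    have contA: "continuous_on UNIV A" unfolding A_def by (intro continuous_intros)
    define O1 where "O1 = A -` S"
    have O1: "open O1" unfolding O1_def using S(1) contA by (simp add: open_vimage)
    have A: "smooth_on A O1" unfolding A_def
      by (intro O1 smooth_on_add smooth_on_scaleR smooth_on_fst smooth_on_snd smooth_on_ident
          smooth_on_const)
    define F where "F q = dd v f (A q)" for q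
    have F: "smooth_on F O1" unfolding F_def
      by (rule smooth_on_compose[OF f' S(1) O1 A]) (auto simp: O1_def)
    have sub: "{0} \<times> {0..b} \<subseteq> O1" using wS b by (auto simp: O1_def A_def w_def)
    have F': "dd (1, 0) F (0, y) = dd u (dd v f) (w y)" if "y \<in> {0..b}" for y
    proof -
      have "((\<lambda>s. F (s, y)) has_vector_derivative dd (1, 0) F (0, y)) (at 0)"
        using dd_vector_derivative[OF F, of "(0, y)" 0 "(1, 0)"] that subsetD[OF sub, of "(0, y)"] by auto
      moreover have "((\<lambda>s. F (s, y)) has_vector_derivative dd u (dd v f) (w y)) (at 0)"
        using dd_vector_derivative[OF f', of "w y" 0 u v] wS[of y] that b
        by (simp add: F_def A_def w_def add_ac)
      ultimately show ?thesis by (rule vector_derivative_unique_at)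
    qed
    have "((\<lambda>s. integral {0..b} (\<lambda>y. F (s, y))) has_real_derivative
             integral {0..b} (\<lambda>y. dd (1, 0) F (0, y))) (at 0)"
      using has_real_derivative_integral_compact[OF _ O1 sub F] by simp
    also have "integral {0..b} (\<lambda>y. dd (1, 0) F (0, y)) = integral {0..b} (\<lambda>y. dd u (dd v f) (w y))"
      by (rule integral_cong) (rule F')
    finally have 1: "((\<lambda>s. integral {0..b} (\<lambda>y. F (s, y))) has_real_derivative
             integral {0..b} (\<lambda>y. dd u (dd v f) (w y))) (at 0)" .
    \<comment> \<open>For s in \<open>X\<close> the whole segment in direction v stays in S, so the
      fundamental theorem of calculus applies along it.\<close>
    obtain X where X: "0 \<in> X" "open X" "X \<times> {0..b} \<subseteq> O1" using Elementary_Topology.tube_lemma[OF _ O1 sub] by auto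
    have 2: "((\<lambda>s. integral {0..b} (\<lambda>y. F (s, y))) has_real_derivative (dd u f (w b) - dd u f p)) (at 0)"
    proof (rule has_field_derivative_transform_within_open[OF _ X(2,1)])
      show "((\<lambda>s. f (w b + s *\<^sub>R u) - f (p + s *\<^sub>R u)) has_real_derivative (dd u f (w b) - dd u f p)) (at 0)"
        using dd_vector_derivative[OF f, of "w b" 0 u] dd_vector_derivative[OF f, of p 0 u] wS[OF b] S(2)
        by (auto simp: has_real_derivative_iff_has_vector_derivative intro!: derivative_intros)
      fix s assume s: "s \<in> X"
      have mem: "p + s *\<^sub>R u + y *\<^sub>R v \<in> S" if "y \<in> {0..b}" for y
        using subsetD[OF X(3), of "(s, y)"] s that by (simp add: O1_def A_def)
      have "((\<lambda>y. F (s, y)) has_integral (f (p + s *\<^sub>R u + b *\<^sub>R v) - f (p + s *\<^sub>R u + 0 *\<^sub>R v))) {0..b}"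
      proof (rule fundamental_theorem_of_calculus)
        fix y assume "y \<in> {0..b}"
        then have "((\<lambda>y. f (p + s *\<^sub>R u + y *\<^sub>R v)) has_vector_derivative F (s, y)) (at y)"
          using dd_vector_derivative[OF f mem] by (simp add: F_def A_def)
        then show "((\<lambda>y. f (p + s *\<^sub>R u + y *\<^sub>R v)) has_vector_derivative F (s, y)) (at y within {0..b})"
          by (rule has_vector_derivative_at_within)
      qed (use b in auto)
      then show "f (w b + s *\<^sub>R u) - f (p + s *\<^sub>R u) = integral {0..b} (\<lambda>y. F (s, y))"
        by (simp add: integral_unique w_def add_ac)
    qed
    show ?thesis using DERIV_unique[OF 1 2] .
  qed
  \<comment> \<open>By \<open>mixed\<close>, \<open>I b\<close> is also the increment of
    \<open>dd u f\<close> along v. The two expressions are differentiated at b = 0 from the right,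
    where derivatives are still unique.\<close>
  define I where "I b = integral {0..b} (\<lambda>y. dd u (dd v f) (w y))" for b
  have "(I has_vector_derivative dd u (dd v f) (w 0)) (at 0 within {0..r})"
    unfolding I_def using r by (intro integral_has_vector_derivative contw f'') auto
  moreover have "(I has_vector_derivative dd v (dd u f) (w 0)) (at 0 within {0..r})"
  proof (rule has_vector_derivative_transform)
    show "((\<lambda>b. dd u f (w b) - dd u f p) has_vector_derivative dd v (dd u f) (w 0)) (at 0 within {0..r})"
      using dd_vector_derivative[OF smooth_on_dd[OF f, of u], of p 0 v] S(2)
      by (auto intro!: derivative_eq_intros simp: w_def intro: has_vector_derivative_at_within)
  qed (use mixed r in \<open>auto simp: I_def\<close>)
  moreover have "at (0::real) within {0..r} \<noteq> bot"
    using r by (simp add: at_within_Icc_at_right)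
  ultimately have "dd u (dd v f) (w 0) = dd v (dd u f) (w 0)"
    by (intro vector_derivative_unique_within)
  then show ?thesis by (simp add: w_def)
qed

subsection \<open>The fundamental lemma of the calculus of variations\<close>

lemma dd_vec_nth:
  assumes "f differentiable (at p)"
  shows "dd v (\<lambda>x. f x $ i) p = dd v f p $ i"
proof -
  have "((\<lambda>x. f x $ i) has_derivative (\<lambda>v. dd v f p $ i)) (at p)"
    using assms bounded_linear.has_derivative[OF bounded_linear_vec_nth]
    by (auto simp: frechet_derivative_works)
  then show ?thesis by (rule dd_eqI)
qed

lemma dd_commute:
  fixes f :: "'a::euclidean_space \<Rightarrow> real^'i::finite"
  assumes S: "open S" "p \<in> S" and f: "smooth_on f S"
  shows "dd u (dd v f) p = dd v (dd u f) p"
proof (simp add: vec_eq_iff, rule allI)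
  fix i
  have *: "dd u (dd v f) p $ i = dd u (dd v (\<lambda>x. f x $ i)) p" for u v
  proof -
    have "dd u (dd v f) p $ i = dd u (\<lambda>x. dd v f x $ i) p"
      using smooth_on_differentiable[OF smooth_on_dd[OF f] S(2)] by (simp add: dd_vec_nth)
    also have "\<dots> = dd u (dd v (\<lambda>x. f x $ i)) p"
      by (rule dd_transform[OF S]) (simp add: dd_vec_nth smooth_on_differentiable[OF f])
    finally show ?thesis .
  qed
  show "dd u (dd v f) p $ i = dd v (dd u f) p $ i"
    unfolding * by (rule dd_commute_real[OF S smooth_on_vec_nth[OF S(1) f]])
qed

text \<open>\<open>bump 0\<close> is the classical function exp(-1/y), flat at 0. The powers of 1/y
  are included so that derivatives stay in the span of the family, which makes smoothness an
  induction.\<close>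

definition bump :: "nat \<Rightarrow> real \<Rightarrow> real" where
  "bump n y = (if y > 0 then exp (- inverse y) * inverse y ^ n else 0)"

text \<open>With N = n + 2 the inequality (1 + z/N)^N \<le> exp z, at z = 1/y, beats the power z^n
  with two orders to spare. The quadratic bound gives the derivative 0 at y = 0, the only point
  where \<open>bump_has_derivative\<close> is not plain calculus.\<close>

lemma bump_le_square: "\<bar>bump n y\<bar> \<le> real (n + 2) ^ (n + 2) * y\<^sup>2"
proof (cases "y > 0")
  case True
  define z where "z = inverse y"
  have z: "z > 0" "y = inverse z" using True by (auto simp: z_def)
  have "(z / real (n + 2)) ^ (n + 2) \<le> (1 + z / real (n + 2)) ^ (n + 2)"
    using z by (intro power_mono) auto
  also have "\<dots> \<le> exp z" using z by (intro exp_ge_one_plus_x_over_n_power_n) auto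
  finally have "z ^ n * z\<^sup>2 \<le> exp z * real (n + 2) ^ (n + 2)"
    by (simp add: power_divide divide_le_eq power_add power2_eq_square mult_ac del: of_nat_add)
  then have "exp (- z) * z ^ n \<le> real (n + 2) ^ (n + 2) * (inverse z)\<^sup>2"
    using z by (simp add: exp_minus field_simps del: of_nat_add)
  then show ?thesis using True z by (simp add: bump_def del: of_nat_add)
qed (simp add: bump_def)

lemma bump_has_derivative:
  "(bump n has_real_derivative bump (n + 2) y - real n * bump (n + 1) y) (at y)"
proof -
  consider "y > 0" | "y < 0" | "y = 0" by linarith
  then show ?thesis
  proof cases
    case 1
    have d: "(inverse has_real_derivative - (inverse y)\<^sup>2) (at y)"
      using 1 DERIV_inverse[of y] by (simp add: power2_eq_square)
    have "((\<lambda>y. exp (- inverse y) * inverse y ^ n) has_real_derivative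
        bump (n + 2) y - real n * bump (n + 1) y) (at y)"
      by (rule DERIV_cong[OF DERIV_mult[OF DERIV_chain2[OF DERIV_exp DERIV_minus[OF d]] DERIV_power[OF d, of n]]])
         (use 1 in \<open>cases n; simp add: bump_def algebra_simps power2_eq_square\<close>)
    then show ?thesis
      by (rule has_field_derivative_transform_within_open[of _ _ _ "{0<..}"])
         (use 1 in \<open>auto simp: bump_def\<close>)
  next
    case 2
    have "((\<lambda>_. 0::real) has_real_derivative 0) (at y)" by simp
    then have "(bump n has_real_derivative 0) (at y)"
      by (rule has_field_derivative_transform_within_open[of _ _ _ "{..<0}"])
         (use 2 in \<open>auto simp: bump_def\<close>)
    then show ?thesis using 2 by (simp add: bump_def)
  next
    case 3
    define C where "C = real (n + 2) ^ (n + 2)"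
    have "C > 0" by (simp add: C_def)
    have "(bump n has_real_derivative 0) (at 0)"
      unfolding has_field_derivative_def has_derivative_at_alt
    proof (intro conjI allI impI)
      fix \<epsilon> :: real assume "\<epsilon> > 0"
      show "\<exists>d>0. \<forall>z. norm (z - 0) < d \<longrightarrow> norm (bump n z - bump n 0 - 0 * (z - 0)) \<le> \<epsilon> * norm (z - 0)"
      \<comment> \<open>The radius comes from C z^2 \<le> \<epsilon> \<bar>z\<bar>.\<close>
      proof (intro exI[of _ "\<epsilon> / C"] conjI allI impI)
        fix z :: real assume "norm (z - 0) < \<epsilon> / C"
        then have "C * \<bar>z\<bar> \<le> \<epsilon>" using \<open>C > 0\<close> by (simp add: field_simps)
        then have "C * \<bar>z\<bar> * \<bar>z\<bar> \<le> \<epsilon> * \<bar>z\<bar>" by (rule mult_right_mono) simp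
        moreover have "C * \<bar>z\<bar> * \<bar>z\<bar> = C * z\<^sup>2"
          by (metis mult.assoc abs_mult_self_eq power2_eq_square)
        ultimately have "\<bar>bump n z\<bar> \<le> \<epsilon> * \<bar>z\<bar>"
          using bump_le_square[of n z] unfolding C_def by linarith
        then show "norm (bump n z - bump n 0 - 0 * (z - 0)) \<le> \<epsilon> * norm (z - 0)"
          by (simp add: bump_def[of n 0])
      qed (use \<open>C > 0\<close> \<open>\<epsilon> > 0\<close> in auto)
    qed (rule bounded_linear_mult_right)
    then show ?thesis using 3 by (simp add: bump_def)
  qed
qed

lemma smooth_on_bump: "smooth_on (bump n) UNIV"
proof -
  have "Ck_on r (bump n) UNIV" for r n
  proof (induction r arbitrary: n)
    case 0
    then show ?case
      using DERIV_isCont[OF bump_has_derivative] by (simp add: continuous_on_eq_continuous_at)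
  next
    case (Suc r)
    have D: "(bump n has_derivative (\<lambda>v. (bump (n + 2) y - real n * bump (n + 1) y) * v)) (at y)" for n y
      using bump_has_derivative by (simp add: has_field_derivative_def)
    have "Ck_on r (\<lambda>y. v * (bump (n + 2) y + - real n * bump (n + 1) y)) UNIV" for v
      by (intro Ck_on_bounded_linear[OF bounded_linear_mult_right] Ck_on_add Suc) auto
    moreover have "dd v (bump n) = (\<lambda>y. v * (bump (n + 2) y + - real n * bump (n + 1) y))" for v
      using dd_eqI[OF D] by (auto simp: fun_eq_iff)
    moreover have "bump n differentiable (at y)" for y using D by (rule differentiableI)
    ultimately show ?case by simp
  qed
  then show ?thesis by (simp add: smooth_on_def)
qed

text \<open>At an interior point with a nonzero value, E keeps its sign on a small ball, and a bump
  there contradicts \<open>orth\<close>. The remaining points of Z are limits of interior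
  ones.\<close>

lemma fundamental_lemma_calculus_of_variations:
  fixes E :: "'a::euclidean_space \<Rightarrow> real"
  assumes Z: "compact Z" "closure (interior Z) = Z" and E: "continuous_on Z E"
    and orth: "\<And>\<phi> K. smooth_on \<phi> UNIV \<Longrightarrow> compact K \<Longrightarrow> K \<subseteq> interior Z \<Longrightarrow>
        (\<And>p. p \<notin> K \<Longrightarrow> \<phi> p = 0) \<Longrightarrow> integral Z (\<lambda>p. E p * \<phi> p) = 0"
    and p: "p \<in> Z"
  shows "E p = 0"
proof -
  have int: "E q = 0" if q: "q \<in> interior Z" for q
  proof (rule ccontr)
    assume "E q \<noteq> 0"
    \<comment> \<open>Multiplying E by its own value at q makes it positive there and avoids two
      cases by sign.\<close>
    define c where "c = E q"
    have "isCont E q" using E q continuous_on_interior by blast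
    then have "isCont (\<lambda>x. c * E x) q" by (intro continuous_intros)
    moreover have "c * E q > 0" using \<open>E q \<noteq> 0\<close> by (auto simp: c_def zero_less_mult_iff)
    ultimately have "\<forall>\<^sub>F x in nhds q. c * E x > 0"
      unfolding continuous_at eventually_nhds_conv_at by (auto intro: order_tendstoD)
    moreover have "\<forall>\<^sub>F x in nhds q. x \<in> interior Z"
      using q by (intro eventually_nhds_in_open) auto
    ultimately have "\<forall>\<^sub>F x in nhds q. c * E x > 0 \<and> x \<in> interior Z" by eventually_elim auto
    then obtain d where d: "d > 0" "\<And>x. dist x q < d \<Longrightarrow> c * E x > 0 \<and> x \<in> interior Z"
      unfolding eventually_nhds_metric by blast
    define r where "r = d / 2"
    \<comment> \<open>The squared distance, unlike the distance, is smooth at the centre; the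
      argument of \<open>bump\<close> is positive exactly inside the ball.\<close>
    define \<phi> where "\<phi> x = bump 0 (r\<^sup>2 - (x - q) \<bullet> (x - q))" for x
    have r: "r > 0" "cball q r \<subseteq> interior Z" "\<And>x. x \<in> cball q r \<Longrightarrow> c * E x > 0"
      using d by (auto simp: r_def dist_commute)
    have \<phi>: "smooth_on \<phi> UNIV"
      unfolding \<phi>_def
      by (rule smooth_on_compose[OF smooth_on_bump])
         (intro smooth_on_diff smooth_on_inner smooth_on_ident smooth_on_const open_UNIV | simp)+
    have \<phi>0: "\<phi> x = 0" if "x \<notin> cball q r" for x
    proof -
      have "r < norm (x - q)" using that by (simp add: dist_norm norm_minus_commute)
      then have "r\<^sup>2 < (norm (x - q))\<^sup>2" using r(1) by (intro power_strict_mono) auto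
      then show ?thesis by (simp add: \<phi>_def bump_def power2_norm_eq_inner)
    qed
    have \<phi>_nonneg: "\<phi> x \<ge> 0" for x by (simp add: \<phi>_def bump_def)
    have nonneg: "c * E x * \<phi> x \<ge> 0" for x
      using r(3)[of x] \<phi>0[of x] \<phi>_nonneg[of x] by (cases "x \<in> cball q r") auto
    have "integral Z (\<lambda>x. E x * \<phi> x) = 0"
      by (rule orth[OF \<phi> _ r(2) \<phi>0]) auto
    then have 0: "integral Z (\<lambda>x. c * E x * \<phi> x) = 0"
      using integral_mult_right[of Z c "\<lambda>x. E x * \<phi> x"] by (simp add: mult.assoc)
    have cont: "continuous_on Z (\<lambda>x. c * E x * \<phi> x)"
      using continuous_on_subset[OF smooth_on_continuous[OF \<phi>] subset_UNIV] E
      by (intro continuous_intros)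
    \<comment> \<open>On a closed box a nonnegative continuous function with zero integral vanishes.
      Its integral over this box is squeezed between 0 and the integral over Z.\<close>
    obtain a b where ab: "cbox a b \<subseteq> interior Z" "q \<in> box a b"
      using open_contains_cbox[OF open_interior q] by metis
    have abZ: "cbox a b \<subseteq> Z" using ab(1) interior_subset by blast
    have "integral (cbox a b) (\<lambda>x. c * E x * \<phi> x) \<le> integral Z (\<lambda>x. c * E x * \<phi> x)"
      using abZ nonneg Z(1) cont
      by (intro integral_subset_le continuous_on_compact_integrable)
        (auto intro: continuous_on_subset)
    moreover have "integral (cbox a b) (\<lambda>x. c * E x * \<phi> x) \<ge> 0"
      using abZ nonneg cont
      by (intro integral_nonneg continuous_on_compact_integrable) (auto intro: continuous_on_subset)
    ultimately have "integral (cbox a b) (\<lambda>x. c * E x * \<phi> x) = 0" using 0 by simp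
    then have "c * E q * \<phi> q = 0"
      using integral_cbox_eq_0_iff[of a b "\<lambda>x. c * E x * \<phi> x"] ab(2) nonneg
        continuous_on_subset[OF cont abZ] box_subset_cbox[of a b] by auto
    moreover have "\<phi> q > 0" using r(1) by (simp add: \<phi>_def bump_def)
    moreover have "c * E q > 0" using r by auto
    ultimately show False by (metis less_irrefl mult_pos_pos)
  qed
  then show ?thesis
    using continuous_constant_on_closure[of "interior Z" E 0 p] E Z(2) p by simp
qed

subsection \<open>Pullbacks and volume densities\<close>

lemma dd_compose:
  assumes "f differentiable (at (g p))" "(g has_derivative g') (at p)"
  shows "dd v (\<lambda>x. f (g x)) p = dd (g' v) f (g p)"
  using assms has_derivative_compose[of g g' p UNIV f "frechet_derivative f (at (g p))"]
  by (intro dd_eqI) (auto simp: frechet_derivative_works)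

text \<open>\<open>dt\<close> and \<open>pd\<close> freeze the other variables, while smoothness is
  assumed jointly. This lemma and \<open>pd_slice\<close> turn both into directional derivatives on
  the product.\<close>

lemma dt_slice:
  assumes "F differentiable (at (t, \<xi>))"
  shows "dt (\<lambda>s. F (s, \<xi>)) t = dd (1, 0) F (t, \<xi>)"
proof -
  let ?F' = "frechet_derivative F (at (t, \<xi>))"
  have "((\<lambda>s. (s, \<xi>)) has_derivative (\<lambda>r. (r, 0))) (at t)"
    by (auto intro!: derivative_eq_intros)
  from has_derivative_compose[OF this, of F ?F']
  have "((\<lambda>s. F (s, \<xi>)) has_derivative (\<lambda>r. ?F' (r, 0))) (at t)"
    using assms by (simp add: frechet_derivative_works)
  also have "(\<lambda>r. ?F' (r, 0)) = (\<lambda>r. r *\<^sub>R ?F' (1, 0))"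
  proof
    fix r show "?F' (r, 0) = r *\<^sub>R ?F' (1, 0)"
      using linear_cmul[OF linear_frechet_derivative[OF assms], of r "(1, 0)"] by simp
  qed
  finally have "((\<lambda>s. F (s, \<xi>)) has_vector_derivative ?F' (1, 0)) (at t)"
    unfolding has_vector_derivative_def .
  then show ?thesis unfolding dt_def by (rule vector_derivative_at)
qed

lemma pd_slice:
  assumes "F differentiable (at (t, \<xi>))"
  shows "pd i (\<lambda>\<eta>. F (t, \<eta>)) \<xi> = dd (0, axis i 1) F (t, \<xi>)"
  unfolding pd_def using assms
  by (subst dd_compose[of F "\<lambda>\<eta>. (t, \<eta>)" _ "\<lambda>v. (0, v)"]) (auto intro!: derivative_eq_intros)

lemma dd_eq_sum_pd:
  fixes f :: "real^'i::finite \<Rightarrow> 'b::real_normed_vector"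
  assumes "f differentiable (at T)"
  shows "dd v f T = (\<Sum>i\<in>UNIV. v $ i *\<^sub>R pd i f T)"
proof -
  have "v = (\<Sum>i\<in>UNIV. v $ i *\<^sub>R axis i 1)"
    by (simp add: vec_eq_iff axis_def if_distrib cong: if_cong)
  then have "dd v f T = frechet_derivative f (at T) (\<Sum>i\<in>UNIV. v $ i *\<^sub>R axis i 1)" by simp
  then show ?thesis
    using linear_frechet_derivative[OF assms] by (simp add: linear_sum linear_cmul pd_def)
qed

lemma inner_grad: "f differentiable (at T) \<Longrightarrow> grad f T \<bullet> v = dd v f T"
  by (simp add: dd_eq_sum_pd inner_vec_def grad_def mult.commute)

lemma smooth_on_divide:
  fixes f g :: "'a::real_normed_vector \<Rightarrow> real"
  assumes "open S" "smooth_on f S" "smooth_on g S" "\<And>p. p \<in> S \<Longrightarrow> g p > 0"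
  shows "smooth_on (\<lambda>p. f p / g p) S"
proof -
  have "smooth_on (\<lambda>p. f p / g p) S \<longleftrightarrow> smooth_on (\<lambda>p. f p * g p powr (-1)) S"
    using assms by (intro smooth_on_cong) (auto simp: powr_minus_divide abs_of_pos)
  then show ?thesis using smooth_on_mult[OF assms(1,2) smooth_on_powr[OF assms(1,3,4)]] by blast
qed

text \<open>Nondegeneracy in determinant form: visibly an open condition, and the domain on which
  \<open>vol\<close> is smooth and positive.\<close>

definition nondegenerate_tensors :: "(real^('k::finite + 'k \<Rightarrow> 'd::finite)) set" where
  "nondegenerate_tensors = {T. det (tensor_matrix T) \<noteq> 0}"

text \<open>\<open>nondegenerate\<close> tests the left argument, hence the transpose: a nonzero
  vector in the kernel of the transposed matrix pairs to zero with every v.\<close>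

lemma nondegenerate_imp_det: "nondegenerate T \<Longrightarrow> T \<in> nondegenerate_tensors"
proof (rule ccontr)
  assume T: "nondegenerate T" and "T \<notin> nondegenerate_tensors"
  then have "\<not> invertible (transpose (tensor_matrix T))"
    by (simp add: nondegenerate_tensors_def invertible_det_nz det_transpose)
  then obtain u where u: "u \<noteq> 0" "transpose (tensor_matrix T) *v u = 0"
    using invertible_left_inverse matrix_left_invertible_ker by metis
  then have "u \<bullet> (tensor_matrix T *v v) = 0" for v
    by (metis dot_lmul_matrix inner_zero_left transpose_matrix_vector)
  then show False using T u(1) by (auto simp: nondegenerate_def)
qed

lemma smooth_on_det_tensor_matrix: "smooth_on (\<lambda>T. det (tensor_matrix T)) UNIV"
  unfolding det_def tensor_matrix_def vec_lambda_beta
  by (intro smooth_on_sum smooth_on_mult smooth_on_const smooth_on_prod smooth_on_vec_nth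
      smooth_on_ident open_UNIV)

lemma open_nondegenerate_tensors: "open nondegenerate_tensors"
proof -
  have "nondegenerate_tensors = (\<lambda>T. det (tensor_matrix T)) -` (- {0})"
    by (auto simp: nondegenerate_tensors_def)
  then show ?thesis
    using open_vimage[OF open_Compl[OF closed_singleton] smooth_on_continuous[OF smooth_on_det_tensor_matrix], of 0]
    by metis
qed

lemma smooth_on_vol: "smooth_on vol nondegenerate_tensors"
  unfolding vol_def
  by (intro smooth_on_abs_powr open_nondegenerate_tensors
        smooth_on_subset[OF smooth_on_det_tensor_matrix]) (auto simp: nondegenerate_tensors_def)

lemma vol_pos: "T \<in> nondegenerate_tensors \<Longrightarrow> vol T > 0"
  by (simp add: vol_def nondegenerate_tensors_def)

lemma grad_ln_vol:
  assumes "T + D \<in> nondegenerate_tensors"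
  shows "grad (\<lambda>D. ln (vol (T + D))) D = (1 / vol (T + D)) *\<^sub>R grad vol (T + D)"
proof -
  have "((\<lambda>D. T + D) has_derivative (\<lambda>v. v)) (at D)"
    by (auto intro!: derivative_eq_intros)
  from has_derivative_compose[OF this smooth_on_has_derivative[OF smooth_on_vol assms]]
  have "((\<lambda>D. vol (T + D)) has_derivative frechet_derivative vol (at (T + D))) (at D)" .
  then have "((\<lambda>D. ln (vol (T + D))) has_derivative
      (\<lambda>v. frechet_derivative vol (at (T + D)) v / vol (T + D))) (at D)"
    using vol_pos[OF assms] by (auto intro!: derivative_eq_intros simp: divide_inverse)
  from dd_eqI[OF this] show ?thesis
    by (simp add: vec_eq_iff grad_def pd_def)
qed

text \<open>
  The pullback along the slices \<open>\<eta> \<mapsto> c + j \<eta>\<close> of a parameter space, as a function on that space.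
\<close>

definition pull ::
  "(real^'d::finite \<Rightarrow> 'p::euclidean_space) \<Rightarrow> (real^'n::finite \<Rightarrow> real^('s::finite \<Rightarrow> 'n)) \<Rightarrow>
   ('p \<Rightarrow> real^'n) \<Rightarrow> 'p \<Rightarrow> real^('s \<Rightarrow> 'd)" where
  "pull j Theta f p =
    (\<chi> a. \<Sum>b\<in>UNIV. Theta (f p) $ b * (\<Prod>r\<in>UNIV. dd (j (axis (a r) 1)) f p $ b r))"

text \<open>Applied with \<open>j = Pair 0\<close> on pairs (t, \<xi>) and with v sent to
  \<open>(0, 0, v)\<close> on triples (\<epsilon>, t, \<xi>). Smoothness and derivatives of both
  pullbacks then follow from one jointly smooth map.\<close>

lemma pullback_eq_pull:
  assumes "bounded_linear j" "f differentiable (at (c + j \<xi>))"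
  shows "pullback Theta (\<lambda>\<eta>. f (c + j \<eta>)) \<xi> = pull j Theta f (c + j \<xi>)"
proof -
  have "((\<lambda>\<eta>. c + j \<eta>) has_derivative j) (at \<xi>)"
    using bounded_linear_imp_has_derivative[OF assms(1)] by (auto intro!: derivative_eq_intros)
  then have "dd v (\<lambda>\<eta>. f (c + j \<eta>)) \<xi> = dd (j v) f (c + j \<xi>)" for v
    by (rule dd_compose[of f "\<lambda>\<eta>. c + j \<eta>" \<xi> j v, OF assms(2)])
  then show ?thesis by (simp add: pullback_def pull_def pd_def)
qed

lemma smooth_on_pull:
  assumes "open S" "smooth_on f S" "open M" "smooth_on Theta M" "f ` S \<subseteq> M"
  shows "smooth_on (pull j Theta f) S"
  unfolding pull_def
  by (intro smooth_on_vec smooth_on_sum smooth_on_mult smooth_on_vec_nth smooth_on_prod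
      smooth_on_dd smooth_on_compose[OF assms(4,3,1,2,5)] assms)

text \<open>The product rule: either \<open>Theta\<close> moves along f, or the factor of one slot s
  is differentiated. For the variation, the first kind leads to \<open>f_Theta\<close> and the
  second to \<open>Sigma_tilde\<close>.\<close>

lemma dd_pull:
  assumes S: "open S" "p \<in> S" and f: "smooth_on f S" and M: "smooth_on Theta M" "f p \<in> M"
  shows "dd u (pull j Theta f) p $ a =
    (\<Sum>b\<in>UNIV. dd (dd u f p) Theta (f p) $ b * (\<Prod>r\<in>UNIV. dd (j (axis (a r) 1)) f p $ b r)
      + Theta (f p) $ b * (\<Sum>s\<in>UNIV. dd u (dd (j (axis (a s) 1)) f) p $ b s *
          (\<Prod>r\<in>UNIV - {s}. dd (j (axis (a r) 1)) f p $ b r)))"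
proof -
  note nth = bounded_linear.has_derivative[OF bounded_linear_vec_nth]
  note Df = smooth_on_has_derivative[OF f S(2)]
  have DT: "((\<lambda>p. Theta (f p)) has_derivative (\<lambda>u. dd (dd u f p) Theta (f p))) (at p)"
    using has_derivative_compose[OF Df smooth_on_has_derivative[OF M]] .
  have D: "((\<lambda>p. \<Sum>b\<in>UNIV. Theta (f p) $ b * (\<Prod>r\<in>UNIV. dd (j (axis (a r) 1)) f p $ b r)) has_derivative
    (\<lambda>u. \<Sum>b\<in>UNIV. Theta (f p) $ b * (\<Sum>s\<in>UNIV. dd u (dd (j (axis (a s) 1)) f) p $ b s *
          (\<Prod>r\<in>UNIV - {s}. dd (j (axis (a r) 1)) f p $ b r)) +
      dd (dd u f p) Theta (f p) $ b * (\<Prod>r\<in>UNIV. dd (j (axis (a r) 1)) f p $ b r))) (at p)" for a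
    by (intro has_derivative_sum has_derivative_mult has_derivative_prod nth DT
        smooth_on_has_derivative[OF smooth_on_dd[OF f] S(2)])
  have "dd u (\<lambda>p. \<Sum>b\<in>UNIV. Theta (f p) $ b * (\<Prod>r\<in>UNIV. dd (j (axis (a r) 1)) f p $ b r)) p =
    (\<Sum>b\<in>UNIV. dd (dd u f p) Theta (f p) $ b * (\<Prod>r\<in>UNIV. dd (j (axis (a r) 1)) f p $ b r)
      + Theta (f p) $ b * (\<Sum>s\<in>UNIV. dd u (dd (j (axis (a s) 1)) f) p $ b s *
          (\<Prod>r\<in>UNIV - {s}. dd (j (axis (a r) 1)) f p $ b r)))"
    by (subst dd_eqI[OF D]) (simp add: add.commute)
  moreover have "pull j Theta f differentiable (at p)"
  proof -
    have "((\<lambda>p. pull j Theta f p $ a) differentiable (at p))" for a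
      unfolding pull_def vec_lambda_beta differentiable_def using D by blast
    then have "((\<lambda>p. \<Sum>a\<in>UNIV. (pull j Theta f p $ a) *\<^sub>R axis a (1::real)) differentiable (at p))"
      by (intro differentiable_sum differentiable_scaleR) auto
    moreover have "(\<lambda>p. \<Sum>a\<in>UNIV. (pull j Theta f p $ a) *\<^sub>R axis a (1::real)) = pull j Theta f"
      by (simp flip: vec_eq_sum_axis)
    ultimately show ?thesis by simp
  qed
  ultimately show ?thesis
    by (subst dd_vec_nth[symmetric]) (simp_all add: pull_def)
qed

subsection \<open>Histories of an elastic body\<close>

locale elastic_history =
  fixes Theta :: "real^'n::finite \<Rightarrow> real^('k::finite + 'k \<Rightarrow> 'n)"
    and F0 :: "real^'d::finite \<Rightarrow> real^('k + 'k \<Rightarrow> 'd) \<Rightarrow> real^('k + 'k \<Rightarrow> 'd) \<Rightarrow> real"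
    and U :: "real^'n \<Rightarrow> real"
    and e :: "real \<Rightarrow> real"
    and x :: "real \<Rightarrow> real^'d \<Rightarrow> real^'n"
    and M :: "(real^'n) set" and B N :: "(real^'d) set"
    and G :: "(real \<times> (real^'d)) set" and J :: "real set"
  assumes M: "open M" "smooth_on Theta M" "smooth_on U M"
    and body: "compact B" "closure (interior B) = B"
    and energy: "open N" "B \<subseteq> N" "smooth_on (\<lambda>(\<xi>, D, V). F0 \<xi> D V) (N \<times> UNIV \<times> UNIV)"
    and metric: "open J" "{0..1} \<subseteq> J" "smooth_on e J" "\<And>t. t \<in> {0..1} \<Longrightarrow> e t > 0"
    and history: "open G" "{0..1} \<times> B \<subseteq> G" "smooth_on (case_prod x) G"
      "\<And>t \<xi>. t \<in> {0..1} \<Longrightarrow> \<xi> \<in> B \<Longrightarrow> x t \<xi> \<in> M"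
    and nondeg: "\<And>t \<xi>. t \<in> {0..1} \<Longrightarrow> \<xi> \<in> B \<Longrightarrow> nondegenerate (pullback Theta (x t) \<xi>)"
begin

abbreviation "Pb \<equiv> \<lambda>t. pullback Theta (x t)"
abbreviation "FF \<equiv> \<lambda>(\<xi>, D, V). F0 \<xi> D V"
abbreviation "state \<equiv> \<lambda>p. (snd p, case_prod (Delta Theta x) p, case_prod (Delta_dot Theta x) p)"

section \<open>The open domain on which the fields of a history are smooth\<close>

definition GM :: "(real \<times> (real^'d)) set" where "GM = {p \<in> G. case_prod x p \<in> M}"

text \<open>The point at time 0 is tested as well because \<open>Delta\<close> subtracts the
  pullback of the initial configuration.\<close>

definition W :: "(real \<times> (real^'d)) set" where
  "W = {p \<in> GM. (0, snd p) \<in> GM \<and> fst p \<in> J \<and> snd p \<in> N \<and> case_prod Pb p \<in> nondegenerate_tensors}"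

lemma open_GM: "open GM"
proof -
  have "GM = G \<inter> case_prod x -` M" by (auto simp: GM_def)
  then show ?thesis
    using continuous_open_preimage[OF smooth_on_continuous[OF history(3)] history(1) M(1)] by simp
qed

lemma smooth_on_x: "smooth_on (case_prod x) GM"
  by (rule smooth_on_subset[OF history(3)]) (auto simp: GM_def)

lemma Pb_eq_pull: "(t, \<xi>) \<in> GM \<Longrightarrow> Pb t \<xi> = pull (Pair 0) Theta (case_prod x) (t, \<xi>)"
  using pullback_eq_pull[of "Pair 0" "case_prod x" "(t, 0)" \<xi> Theta]
    smooth_on_differentiable[OF smooth_on_x, of "(t, \<xi>)"]
  by (simp add: bounded_linear_Pair bounded_linear_zero bounded_linear_ident)

lemma smooth_on_Pb: "smooth_on (case_prod Pb) GM"
proof -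
  have "smooth_on (pull (Pair 0) Theta (case_prod x)) GM"
    by (rule smooth_on_pull[OF open_GM smooth_on_x M(1,2)]) (auto simp: GM_def)
  then show ?thesis
    by (subst smooth_on_cong[OF open_GM, of _ "pull (Pair 0) Theta (case_prod x)"])
       (auto simp: Pb_eq_pull)
qed

lemma open_W: "open W"
proof -
  have 1: "open (GM \<inter> case_prod Pb -` nondegenerate_tensors)"
    using continuous_open_preimage[OF smooth_on_continuous[OF smooth_on_Pb] open_GM
        open_nondegenerate_tensors] .
  have 2: "open ((\<lambda>p::real \<times> (real^'d). (0, snd p)) -` GM)"
    by (intro open_vimage open_GM continuous_intros)
  have "W = (GM \<inter> case_prod Pb -` nondegenerate_tensors) \<inter> ((\<lambda>p. (0, snd p)) -` GM) \<inter> (J \<times> N)"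
    by (auto simp: W_def)
  then show ?thesis using 1 2 open_Times[OF metric(1) energy(1)] by (simp add: open_Int)
qed

lemma Z_subset_W: "{0..1} \<times> B \<subseteq> W"
proof (clarify)
  fix t \<xi> assume p: "t \<in> {0..1::real}" "\<xi> \<in> B"
  have "(0, \<xi>) \<in> GM" "(t, \<xi>) \<in> GM"
    using p history(2) history(4)[of t] history(4)[of 0] by (auto simp: GM_def)
  then show "(t, \<xi>) \<in> W"
    using p metric(2) energy(2) nondegenerate_imp_det[OF nondeg[OF p]] by (auto simp: W_def)
qed

lemma W_subset: "W \<subseteq> GM" by (auto simp: W_def)

lemma smooth_on_Pb_W: "smooth_on (case_prod Pb) W"
  by (rule smooth_on_subset[OF smooth_on_Pb W_subset])

lemma smooth_on_x_W: "smooth_on (case_prod x) W"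
  by (rule smooth_on_subset[OF smooth_on_x W_subset])

lemma smooth_on_Delta: "smooth_on (case_prod (Delta Theta x)) W"
proof -
  have "smooth_on (\<lambda>p. case_prod Pb (0, snd p)) W"
  proof (rule smooth_on_compose[OF smooth_on_Pb open_GM open_W])
    show "smooth_on (\<lambda>p::real \<times> (real^'d). (0::real, snd p)) W"
      by (intro smooth_on_Pair smooth_on_const smooth_on_snd smooth_on_ident open_W)
  qed (auto simp: W_def)
  from smooth_on_diff[OF open_W smooth_on_Pb_W this] show ?thesis
    by (simp add: Delta_def case_prod_beta')
qed

lemma Delta_dot_eq: "(t, \<xi>) \<in> GM \<Longrightarrow> Delta_dot Theta x t \<xi> = dd (1, 0) (case_prod Pb) (t, \<xi>)"
  using dt_slice[of "case_prod Pb" t \<xi>] smooth_on_differentiable[OF smooth_on_Pb, of "(t, \<xi>)"]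
  by (simp add: Delta_dot_def)

lemma smooth_on_Delta_dot: "smooth_on (case_prod (Delta_dot Theta x)) W"
  by (subst smooth_on_cong[OF open_W, of _ "dd (1, 0) (case_prod Pb)"])
     (use W_subset in \<open>auto simp: Delta_dot_eq intro!: smooth_on_dd smooth_on_Pb_W\<close>)

lemma smooth_on_state: "smooth_on state W"
  by (intro smooth_on_Pair smooth_on_snd smooth_on_ident smooth_on_Delta smooth_on_Delta_dot open_W)

lemma open_FF: "open (N \<times> (UNIV :: (real^('k + 'k \<Rightarrow> 'd)) set) \<times> (UNIV :: (real^('k + 'k \<Rightarrow> 'd)) set))"
  by (intro open_Times energy(1) open_UNIV)

lemma smooth_on_FF_state:
  "smooth_on F (N \<times> UNIV \<times> UNIV) \<Longrightarrow> smooth_on (\<lambda>p. F (state p)) W"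
  by (rule smooth_on_compose[OF _ open_FF open_W smooth_on_state]) (auto simp: W_def)

lemma FF_differentiable: "\<xi> \<in> N \<Longrightarrow> FF differentiable (at (\<xi>, D, V))"
  by (rule smooth_on_differentiable[OF energy(3)]) auto

text \<open>\<open>stress\<close> and \<open>momentum\<close> differentiate \<open>F0\<close> in one
  argument with the others frozen; their smoothness in (t, \<xi>) is read off the joint function
  \<open>FF\<close>.\<close>

lemma slice_D: "\<xi> \<in> N \<Longrightarrow> (\<lambda>D. F0 \<xi> D V) differentiable (at D)"
  and dd_slice_D: "\<xi> \<in> N \<Longrightarrow> dd w (\<lambda>D. F0 \<xi> D V) D = dd (0, w, 0) FF (\<xi>, D, V)"
proof -
  assume "\<xi> \<in> N"
  have "((\<lambda>D. (\<xi>, D, V)) has_derivative (\<lambda>w. (0, w, 0))) (at D)"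
    by (auto intro!: derivative_eq_intros)
  from has_derivative_compose[OF this FF_differentiable[OF \<open>\<xi> \<in> N\<close>, of D V, unfolded frechet_derivative_works]]
  have *: "((\<lambda>D. F0 \<xi> D V) has_derivative (\<lambda>w. dd (0, w, 0) FF (\<xi>, D, V))) (at D)"
    by simp
  then show "(\<lambda>D. F0 \<xi> D V) differentiable (at D)" by (rule differentiableI)
  show "dd w (\<lambda>D. F0 \<xi> D V) D = dd (0, w, 0) FF (\<xi>, D, V)" by (rule dd_eqI[OF *])
qed

lemma slice_V: "\<xi> \<in> N \<Longrightarrow> (\<lambda>V. F0 \<xi> D V) differentiable (at V)"
  and dd_slice_V: "\<xi> \<in> N \<Longrightarrow> dd w (\<lambda>V. F0 \<xi> D V) V = dd (0, 0, w) FF (\<xi>, D, V)"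
proof -
  assume "\<xi> \<in> N"
  have "((\<lambda>V. (\<xi>, D, V)) has_derivative (\<lambda>w. (0, 0, w))) (at V)"
    by (auto intro!: derivative_eq_intros)
  from has_derivative_compose[OF this FF_differentiable[OF \<open>\<xi> \<in> N\<close>, of D V, unfolded frechet_derivative_works]]
  have *: "((\<lambda>V. F0 \<xi> D V) has_derivative (\<lambda>w. dd (0, 0, w) FF (\<xi>, D, V))) (at V)"
    by simp
  then show "(\<lambda>V. F0 \<xi> D V) differentiable (at V)" by (rule differentiableI)
  show "dd w (\<lambda>V. F0 \<xi> D V) V = dd (0, 0, w) FF (\<xi>, D, V)" by (rule dd_eqI[OF *])
qed

section \<open>Smoothness of stress, momentum, volume and forces\<close>

lemma smooth_on_stress: "smooth_on (case_prod (stress Theta F0 x)) W"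
proof -
  have "smooth_on (\<lambda>p. \<chi> i. dd (0, axis i 1, 0) FF (state p)) W"
    by (intro smooth_on_vec open_W smooth_on_FF_state smooth_on_dd energy(3))
  then show ?thesis
    by (subst smooth_on_cong[OF open_W, of _ "\<lambda>p. \<chi> i. dd (0, axis i 1, 0) FF (state p)"])
       (auto simp: stress_def grad_def pd_def dd_slice_D W_def)
qed

lemma smooth_on_momentum: "smooth_on (case_prod (momentum Theta F0 x)) W"
proof -
  have "smooth_on (\<lambda>p. \<chi> i. dd (0, 0, axis i 1) FF (state p)) W"
    by (intro smooth_on_vec open_W smooth_on_FF_state smooth_on_dd energy(3))
  then show ?thesis
    by (subst smooth_on_cong[OF open_W, of _ "\<lambda>p. \<chi> i. dd (0, 0, axis i 1) FF (state p)"])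
       (auto simp: momentum_def grad_def pd_def dd_slice_V W_def)
qed

lemma smooth_on_lagrangian: "smooth_on (case_prod (lagrangian Theta F0 U x)) W"
proof -
  have "smooth_on (\<lambda>p. FF (state p) + U (case_prod x p)) W"
    by (intro smooth_on_add open_W smooth_on_FF_state energy(3)
        smooth_on_compose[OF M(3,1) open_W smooth_on_x_W]) (auto simp: W_def GM_def)
  then show ?thesis by (simp add: lagrangian_def case_prod_beta')
qed

lemma smooth_on_varpi: "smooth_on (case_prod (varpi Theta x)) W"
proof -
  have "smooth_on (\<lambda>p. vol (case_prod Pb p)) W"
    by (rule smooth_on_compose[OF smooth_on_vol open_nondegenerate_tensors open_W smooth_on_Pb_W])
       (auto simp: W_def)
  then show ?thesis by (simp add: varpi_def case_prod_beta')
qed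

lemma varpi_pos: "(t, \<xi>) \<in> W \<Longrightarrow> varpi Theta x t \<xi> > 0"
  by (auto simp: W_def varpi_def vol_pos)

lemma smooth_on_e: "smooth_on (\<lambda>p. e (fst p)) W"
proof (rule smooth_on_compose[OF metric(3,1) open_W])
  show "smooth_on (\<lambda>p::real \<times> (real^'d). fst p) W"
    by (intro smooth_on_fst smooth_on_ident open_W)
qed (auto simp: W_def)

lemma smooth_on_upsilon: "smooth_on (case_prod (upsilon Theta e x)) W"
proof -
  have "smooth_on (\<lambda>p. e (fst p) * case_prod (varpi Theta x) p) W"
    by (intro smooth_on_mult open_W smooth_on_e smooth_on_varpi)
  then show ?thesis by (simp add: upsilon_def case_prod_beta')
qed

text \<open>The initial pullback plus \<open>Delta\<close> is the current pullback, so the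
  logarithmic gradient is taken at the current state.\<close>

lemma ln_vol_grad_eq:
  assumes "(t, \<xi>) \<in> W"
  shows "ln_vol_grad Theta x t \<xi> = (1 / varpi Theta x t \<xi>) *\<^sub>R grad vol (Pb t \<xi>)"
  using grad_ln_vol[of "Pb 0 \<xi>" "Delta Theta x t \<xi>"] assms
  by (auto simp: ln_vol_grad_def Delta_def varpi_def W_def)

lemma smooth_on_ln_vol_grad: "smooth_on (case_prod (ln_vol_grad Theta x)) W"
proof -
  have *: "smooth_on (\<lambda>p. dd v vol (case_prod Pb p)) W" for v
    by (rule smooth_on_compose[OF smooth_on_dd[OF smooth_on_vol] open_nondegenerate_tensors open_W smooth_on_Pb_W])
       (auto simp: W_def)
  have "smooth_on (\<lambda>p. (1 / case_prod (varpi Theta x) p) *\<^sub>R (\<chi> i. dd (axis i 1) vol (case_prod Pb p))) W"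
    using varpi_pos
    by (intro smooth_on_scaleR open_W smooth_on_vec smooth_on_divide smooth_on_const smooth_on_varpi *) auto
  then show ?thesis
    by (subst smooth_on_cong[OF open_W,
          of _ "\<lambda>p. (1 / case_prod (varpi Theta x) p) *\<^sub>R (\<chi> i. dd (axis i 1) vol (case_prod Pb p))"])
       (auto simp: ln_vol_grad_eq grad_def pd_def)
qed

lemma dt_momentum:
  "(t, \<xi>) \<in> W \<Longrightarrow> dt (\<lambda>s. momentum Theta F0 x s \<xi>) t = dd (1, 0) (case_prod (momentum Theta F0 x)) (t, \<xi>)"
  using dt_slice[of "case_prod (momentum Theta F0 x)" t \<xi>] smooth_on_differentiable[OF smooth_on_momentum]
  by simp

text \<open>The product e \<pi>, whose time derivative divided by \<open>e\<close> is the covariant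
  derivative in \<open>Sigma_tensor_cov\<close>.\<close>

definition weighted_momentum :: "real \<times> (real^'d) \<Rightarrow> real^('k + 'k \<Rightarrow> 'd)" where
  "weighted_momentum p = e (fst p) *\<^sub>R case_prod (momentum Theta F0 x) p"

lemma smooth_on_weighted_momentum: "smooth_on weighted_momentum W"
  unfolding weighted_momentum_def by (intro smooth_on_scaleR open_W smooth_on_e smooth_on_momentum)

lemma dt_weighted_momentum:
  "(t, \<xi>) \<in> W \<Longrightarrow> dt (\<lambda>s. e s *\<^sub>R momentum Theta F0 x s \<xi>) t = dd (1, 0) weighted_momentum (t, \<xi>)"
  using dt_slice[of weighted_momentum t \<xi>] smooth_on_differentiable[OF smooth_on_weighted_momentum]
  by (simp add: weighted_momentum_def)

lemma smooth_on_T_hat: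
  "smooth_on (\<lambda>p. T_hat Theta F0 U x (fst p) (snd p) (case_prod (ln_vol_grad Theta x) p)) W"
proof -
  have "smooth_on (\<lambda>p. (case_prod (ln_vol_grad Theta x) p \<bullet> case_prod (Delta_dot Theta x) p) *\<^sub>R
      case_prod (momentum Theta F0 x) p -
      case_prod (lagrangian Theta F0 U x) p *\<^sub>R case_prod (ln_vol_grad Theta x) p) W"
    by (intro smooth_on_diff smooth_on_scaleR smooth_on_inner open_W smooth_on_ln_vol_grad
        smooth_on_Delta_dot smooth_on_momentum smooth_on_lagrangian)
  then show ?thesis by (simp add: T_hat_def case_prod_beta')
qed

lemma smooth_on_Sigma_tensor: "smooth_on (case_prod (Sigma_tensor Theta F0 U x)) W"
proof -
  let ?f = "\<lambda>p. case_prod (stress Theta F0 x) p - dd (1, 0) (case_prod (momentum Theta F0 x)) p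
      - T_hat Theta F0 U x (fst p) (snd p) (case_prod (ln_vol_grad Theta x) p)"
  have "smooth_on ?f W"
    by (intro smooth_on_diff open_W smooth_on_stress smooth_on_dd smooth_on_momentum smooth_on_T_hat)
  then show ?thesis
    by (subst smooth_on_cong[OF open_W, of _ ?f]) (auto simp: Sigma_tensor_def dt_momentum)
qed

text \<open>Off \<open>{0..1}\<close> the metric \<open>e\<close> may vanish, and \<open>Sigma_tensor_cov\<close> divides by it.\<close>

definition W1 :: "(real \<times> (real^'d)) set" where "W1 = {p \<in> W. e (fst p) > 0}"

lemma open_W1: "open W1"
proof -
  have "W1 = W \<inter> (\<lambda>p. e (fst p)) -` {0<..}" by (auto simp: W1_def)
  then show ?thesis
    using continuous_open_preimage[OF smooth_on_continuous[OF smooth_on_e] open_W, of "{0<..}"] by simp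
qed

lemma W1_subset: "W1 \<subseteq> W" by (auto simp: W1_def)

lemma Z_subset_W1: "{0..1} \<times> B \<subseteq> W1"
  using Z_subset_W metric(4) by (auto simp: W1_def)

lemma upsilon_pos: "(t, \<xi>) \<in> W1 \<Longrightarrow> upsilon Theta e x t \<xi> > 0"
  by (auto simp: W1_def upsilon_def varpi_pos)

lemma smooth_on_Sigma_tensor_cov: "smooth_on (case_prod (Sigma_tensor_cov Theta F0 U e x)) W1"
proof -
  let ?f = "\<lambda>p. case_prod (stress Theta F0 x) p - (1 / e (fst p)) *\<^sub>R dd (1, 0) weighted_momentum p
      - T_hat Theta F0 U x (fst p) (snd p) (case_prod (ln_vol_grad Theta x) p)"
  have "smooth_on ?f W1"
    by (intro smooth_on_diff open_W1 smooth_on_scaleR smooth_on_divide smooth_on_const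
        smooth_on_subset[OF smooth_on_e W1_subset] smooth_on_subset[OF smooth_on_stress W1_subset]
        smooth_on_subset[OF smooth_on_dd[OF smooth_on_weighted_momentum] W1_subset]
        smooth_on_subset[OF smooth_on_T_hat W1_subset]) (auto simp: W1_def)
  then show ?thesis
    by (subst smooth_on_cong[OF open_W1, of _ ?f])
       (use W1_subset in \<open>auto simp: Sigma_tensor_cov_def dt_weighted_momentum\<close>)
qed

lemma pd_x: "(t, \<xi>) \<in> GM \<Longrightarrow> pd i (x t) \<xi> = dd (0, axis i 1) (case_prod x) (t, \<xi>)"
  using pd_slice[of "case_prod x" t \<xi> i] smooth_on_differentiable[OF smooth_on_x] by simp

lemma smooth_on_pd_x: "smooth_on (\<lambda>p. pd i (x (fst p)) (snd p)) W"
  by (subst smooth_on_cong[OF open_W, of _ "dd (0, axis i 1) (case_prod x)"])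
     (use W_subset in \<open>auto simp: pd_x intro!: smooth_on_dd smooth_on_x_W\<close>)

lemma smooth_on_along_x: "smooth_on F M \<Longrightarrow> smooth_on (\<lambda>p. F (case_prod x p)) W"
  by (rule smooth_on_compose[OF _ M(1) open_W smooth_on_x_W]) (auto simp: W_def GM_def)

lemma smooth_on_Sigma_tilde:
  assumes S: "open V" "V \<subseteq> W" "smooth_on (case_prod S) V"
  shows "smooth_on (case_prod (Sigma_tilde Theta x S \<alpha> A)) V"
proof -
  have "smooth_on (\<lambda>p. \<Sum>s\<in>UNIV. \<Sum>a | a s = \<alpha>. \<Sum>b | b s = A. case_prod S p $ a *
      Theta (case_prod x p) $ b * (\<Prod>r\<in>UNIV - {s}. pd (a r) (x (fst p)) (snd p) $ b r)) V"
    by (intro smooth_on_sum smooth_on_mult smooth_on_prod smooth_on_vec_nth S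
        smooth_on_subset[OF smooth_on_along_x[OF M(2)] S(2)] smooth_on_subset[OF smooth_on_pd_x S(2)])
  then show ?thesis by (simp add: Sigma_tilde_def case_prod_beta')
qed

lemma smooth_on_f_Theta:
  assumes S: "open V" "V \<subseteq> W" "smooth_on (case_prod S) V"
  shows "smooth_on (case_prod (f_Theta Theta x S A)) V"
proof -
  have "smooth_on (pd A Theta) M" unfolding pd_def by (rule smooth_on_dd[OF M(2)])
  then have "smooth_on (\<lambda>p. - (\<Sum>a\<in>UNIV. \<Sum>b\<in>UNIV. case_prod S p $ a *
      pd A Theta (case_prod x p) $ b * (\<Prod>r\<in>UNIV. pd (a r) (x (fst p)) (snd p) $ b r))) V"
    by (intro smooth_on_minus smooth_on_sum smooth_on_mult smooth_on_prod smooth_on_vec_nth S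
        smooth_on_subset[OF smooth_on_along_x S(2)] smooth_on_subset[OF smooth_on_pd_x S(2)])
  then show ?thesis by (simp add: f_Theta_def case_prod_beta')
qed

lemma smooth_on_f_ext: "smooth_on (case_prod (f_ext U x A)) W"
proof -
  have "smooth_on (\<lambda>p. - pd A U (case_prod x p)) W"
    unfolding pd_def by (intro smooth_on_minus open_W smooth_on_along_x smooth_on_dd M(3))
  then show ?thesis by (simp add: f_ext_def case_prod_beta')
qed

lemma pd_weighted_Sigma_tilde:
  assumes "open V" "smooth_on (case_prod w) V" "smooth_on (\<lambda>p. case_prod (Sigma_tilde Theta x S \<alpha> A) p) V"
  shows "(t, \<xi>) \<in> V \<Longrightarrow> pd \<alpha> (\<lambda>\<eta>. w t \<eta> * Sigma_tilde Theta x S \<alpha> A t \<eta>) \<xi> =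
    dd (0, axis \<alpha> 1) (\<lambda>p. case_prod w p * case_prod (Sigma_tilde Theta x S \<alpha> A) p) (t, \<xi>)"
  using pd_slice[of "\<lambda>p. case_prod w p * case_prod (Sigma_tilde Theta x S \<alpha> A) p" t \<xi> \<alpha>]
    smooth_on_differentiable[OF smooth_on_mult[OF assms]] by simp

lemma smooth_on_divergence:
  assumes S: "open V" "V \<subseteq> W1" "smooth_on (case_prod S) V"
  shows "smooth_on (case_prod (divergence Theta x (upsilon Theta e x) S A)) V"
proof -
  note VW = subset_trans[OF S(2) W1_subset]
  note u = smooth_on_subset[OF smooth_on_upsilon VW] and T = smooth_on_Sigma_tilde[OF S(1) VW S(3)]
  let ?f = "\<lambda>p. 1 / case_prod (upsilon Theta e x) p * (\<Sum>\<alpha>\<in>UNIV. dd (0, axis \<alpha> 1)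
      (\<lambda>p. case_prod (upsilon Theta e x) p * case_prod (Sigma_tilde Theta x S \<alpha> A) p) p)"
  have "smooth_on ?f V"
    by (intro smooth_on_mult smooth_on_divide smooth_on_const smooth_on_sum smooth_on_dd S u T)
       (use S upsilon_pos in auto)
  then show ?thesis
    by (subst smooth_on_cong[OF S(1), of _ ?f]) (auto simp: divergence_def pd_weighted_Sigma_tilde[OF S(1) u T])
qed

text \<open>\<open>e\<close> depends on t alone: it is a constant for the derivatives in \<xi> and
  cancels, being positive on \<open>W1\<close>.\<close>

lemma divergence_upsilon_eq_varpi:
  assumes S: "open V" "V \<subseteq> W1" "smooth_on (case_prod S) V" and p: "(t, \<xi>) \<in> V"
  shows "divergence Theta x (upsilon Theta e x) S A t \<xi> = divergence Theta x (varpi Theta x) S A t \<xi>"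
proof -
  note VW = subset_trans[OF S(2) W1_subset]
  note v = smooth_on_subset[OF smooth_on_varpi VW] and T = smooth_on_Sigma_tilde[OF S(1) VW S(3)]
  have "pd \<alpha> (\<lambda>\<eta>. upsilon Theta e x t \<eta> * Sigma_tilde Theta x S \<alpha> A t \<eta>) \<xi> =
      e t * pd \<alpha> (\<lambda>\<eta>. varpi Theta x t \<eta> * Sigma_tilde Theta x S \<alpha> A t \<eta>) \<xi>" for \<alpha>
  proof -
    define f where "f \<eta> = varpi Theta x t \<eta> * Sigma_tilde Theta x S \<alpha> A t \<eta>" for \<eta>
    have "(\<lambda>p. case_prod (varpi Theta x) p * case_prod (Sigma_tilde Theta x S \<alpha> A) p) differentiable (at (t, \<xi>))"
      using smooth_on_differentiable[OF smooth_on_mult[OF S(1) v T] p] .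
    from differentiable_chain_at[of "\<lambda>\<eta>. (t, \<eta>)" \<xi>, OF _ this]
    have "f differentiable (at \<xi>)" by (simp add: f_def[abs_def] o_def)
    then have "((\<lambda>\<eta>. e t * f \<eta>) has_derivative (\<lambda>v. e t * dd v f \<xi>)) (at \<xi>)"
      by (auto simp: frechet_derivative_works intro!: has_derivative_mult_right)
    from dd_eqI[OF this] show ?thesis by (simp add: pd_def f_def[abs_def] upsilon_def mult.assoc)
  qed
  moreover have "e t > 0" using p S(2) by (auto simp: W1_def)
  ultimately show ?thesis by (simp add: divergence_def upsilon_def flip: sum_distrib_left)
qed

end

subsection \<open>The first variation\<close>

text \<open>Groups multi-indices by their entry in slot s, as the restricted sums of
  \<open>Sigma_tilde\<close> do.\<close>

lemma sum_over_fibres: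
  fixes F :: "('s::finite \<Rightarrow> 'd::finite) \<Rightarrow> 'd \<Rightarrow> real"
  shows "(\<Sum>\<alpha>\<in>UNIV. \<Sum>a | a s = \<alpha>. F a \<alpha>) = (\<Sum>a\<in>UNIV. F a (a s))"
proof -
  have "(\<Sum>\<alpha>\<in>UNIV. \<Sum>a | a s = \<alpha>. F a \<alpha>) = (\<Sum>\<alpha>\<in>UNIV. \<Sum>a | a \<in> UNIV \<and> a s = \<alpha>. F a (a s))"
    by (intro sum.cong) auto
  also have "\<dots> = (\<Sum>a\<in>UNIV. F a (a s))"
    by (rule sum.group) auto
  finally show ?thesis .
qed

lemma dd_affine_family:
  fixes a b :: "'p::real_normed_vector \<Rightarrow> 'b::real_normed_vector"
  assumes "a differentiable (at (snd q))" "b differentiable (at (snd q))"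
  shows "dd (r, v) (\<lambda>q. a (snd q) + fst q *\<^sub>R b (snd q)) q =
    dd v a (snd q) + fst q *\<^sub>R dd v b (snd q) + r *\<^sub>R b (snd q)"
proof -
  have "((\<lambda>q. a (snd q)) has_derivative (\<lambda>u. dd (snd u) a (snd q))) (at q)"
    "((\<lambda>q. b (snd q)) has_derivative (\<lambda>u. dd (snd u) b (snd q))) (at q)"
    using assms has_derivative_compose[of snd snd q UNIV, OF bounded_linear_imp_has_derivative[OF bounded_linear_snd]]
    by (auto simp: frechet_derivative_works)
  then have "((\<lambda>q. a (snd q) + fst q *\<^sub>R b (snd q)) has_derivative
      (\<lambda>u. dd (snd u) a (snd q) + (fst q *\<^sub>R dd (snd u) b (snd q) + fst u *\<^sub>R b (snd q)))) (at q)"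
    by (intro has_derivative_add has_derivative_scaleR
        bounded_linear_imp_has_derivative[OF bounded_linear_fst])
  from dd_eqI[OF this, of "(r, v)"] show ?thesis by (simp add: add.assoc)
qed

locale elastic_variation = elastic_history Theta F0 U e x M B N G J
  for Theta :: "real^'n::finite \<Rightarrow> real^('k::finite + 'k \<Rightarrow> 'n)"
    and F0 :: "real^'d::finite \<Rightarrow> real^('k + 'k \<Rightarrow> 'd) \<Rightarrow> real^('k + 'k \<Rightarrow> 'd) \<Rightarrow> real"
    and U e x M B N G J +
  fixes h :: "real \<Rightarrow> real^'d \<Rightarrow> real^'n" and K :: "(real \<times> (real^'d)) set"
  assumes h: "smooth_on (case_prod h) UNIV"
    and K: "compact K" "K \<subseteq> {0<..<1} \<times> interior B" "\<And>t \<xi>. (t, \<xi>) \<notin> K \<Longrightarrow> h t \<xi> = 0"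
begin

abbreviation "y \<equiv> \<lambda>\<epsilon> t \<xi>. x t \<xi> + \<epsilon> *\<^sub>R h t \<xi>"

section \<open>The history with the variation parameter adjoined\<close>

definition varied :: "real \<times> real \<times> (real^'d) \<Rightarrow> real^'n" where
  "varied q = case_prod x (snd q) + fst q *\<^sub>R case_prod h (snd q)"

definition varied_dom :: "(real \<times> real \<times> (real^'d)) set" where
  "varied_dom = {q. snd q \<in> G \<and> varied q \<in> M}"

definition varied_pullback :: "real \<times> real \<times> (real^'d) \<Rightarrow> real^('k + 'k \<Rightarrow> 'd)" where
  "varied_pullback q = pullback Theta (y (fst q) (fst (snd q))) (snd (snd q))"

text \<open>The counterpart of \<open>W\<close> with \<epsilon> as a further variable. The initial
  configuration is tested without \<epsilon>, since it is not varied.\<close>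

definition varied_nondeg_dom :: "(real \<times> real \<times> (real^'d)) set" where
  "varied_nondeg_dom = {q \<in> varied_dom. (0, snd (snd q)) \<in> GM \<and> fst (snd q) \<in> J \<and> snd (snd q) \<in> N \<and>
    varied_pullback q \<in> nondegenerate_tensors}"

text \<open>The support lies over the open time interval. Hence the reference term of
  \<open>Delta\<close> does not depend on \<epsilon>.\<close>

lemma h0: "h 0 \<xi> = 0"
proof -
  have "(0, \<xi>) \<notin> K" using subsetD[OF K(2), of "(0, \<xi>)"] by auto
  then show ?thesis by (rule K(3))
qed

lemma off_K: "p \<notin> K \<Longrightarrow> case_prod h p = 0" using K(3) by (cases p) auto

lemma dd_h_off_K: "p \<notin> K \<Longrightarrow> dd v (case_prod h) p = 0"
  using dd_transform[of "- K" p "case_prod h" "\<lambda>_. 0" v] off_K compact_imp_closed[OF K(1)] by auto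

lemma dd_family:
  assumes "smooth_on a G" "smooth_on b UNIV" "snd q \<in> G"
  shows "dd (r, v) (\<lambda>q. a (snd q) + fst q *\<^sub>R b (snd q)) q =
    dd v a (snd q) + fst q *\<^sub>R dd v b (snd q) + r *\<^sub>R b (snd q)"
  by (rule dd_affine_family) (use assms smooth_on_differentiable in blast)+

lemma open_snd_G: "open (snd -` G :: (real \<times> real \<times> (real^'d)) set)"
  by (intro open_vimage_snd history)

lemma smooth_on_varied: "smooth_on varied (snd -` G)"
  unfolding varied_def
  by (intro smooth_on_add smooth_on_scaleR smooth_on_fst smooth_on_ident open_snd_G
      smooth_on_compose[OF history(3,1)] smooth_on_compose[OF h open_UNIV] smooth_on_snd) auto

lemma open_varied_dom: "open varied_dom"
proof -
  have "varied_dom = snd -` G \<inter> varied -` M" by (auto simp: varied_dom_def)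
  then show ?thesis
    using continuous_open_preimage[OF smooth_on_continuous[OF smooth_on_varied] open_snd_G M(1)] by simp
qed

lemma smooth_on_varied_dom: "smooth_on varied varied_dom"
  by (rule smooth_on_subset[OF smooth_on_varied]) (auto simp: varied_dom_def)

lemma varied_pullback_eq: "q \<in> varied_dom \<Longrightarrow> varied_pullback q = pull (\<lambda>v. (0, 0, v)) Theta varied q"
proof -
  assume q: "q \<in> varied_dom"
  obtain \<epsilon> t \<xi> where [simp]: "q = (\<epsilon>, t, \<xi>)" by (cases q)
  have "bounded_linear (\<lambda>v::real^'d. (0::real, 0::real, v))"
    by (intro bounded_linear_Pair bounded_linear_zero bounded_linear_ident)
  from pullback_eq_pull[OF this, of varied "(\<epsilon>, t, 0)" \<xi> Theta] smooth_on_differentiable[OF smooth_on_varied_dom q]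
  show ?thesis by (simp add: varied_pullback_def varied_def)
qed

lemma smooth_on_varied_pullback: "smooth_on varied_pullback varied_dom"
proof -
  have "smooth_on (pull (\<lambda>v. (0, 0, v)) Theta varied) varied_dom"
    by (rule smooth_on_pull[OF open_varied_dom smooth_on_varied_dom M(1,2)]) (auto simp: varied_dom_def)
  then show ?thesis using smooth_on_cong[of varied_dom varied_pullback, OF open_varied_dom varied_pullback_eq] by blast
qed

lemma open_varied_nondeg_dom: "open varied_nondeg_dom"
proof -
  have 1: "open (varied_dom \<inter> varied_pullback -` nondegenerate_tensors)"
    using continuous_open_preimage[OF smooth_on_continuous[OF smooth_on_varied_pullback] open_varied_dom open_nondegenerate_tensors] .
  have 2: "open ((\<lambda>q::real \<times> real \<times> (real^'d). (0, snd (snd q))) -` GM)"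
    by (intro open_vimage open_GM continuous_intros)
  have 3: "open ((UNIV::real set) \<times> J \<times> N)"
    by (intro open_Times open_UNIV metric(1) energy(1))
  have "varied_nondeg_dom = (varied_dom \<inter> varied_pullback -` nondegenerate_tensors) \<inter> ((\<lambda>q. (0, snd (snd q))) -` GM) \<inter> (UNIV \<times> J \<times> N)"
    by (auto simp: varied_nondeg_dom_def)
  then show ?thesis
    using open_Int[OF open_Int[OF 1 2] 3] by (simp only:)
qed

lemma W_subset_varied_nondeg_dom: "p \<in> W \<Longrightarrow> (0, p) \<in> varied_nondeg_dom"
  by (auto simp: W_def varied_nondeg_dom_def varied_dom_def GM_def varied_def varied_pullback_def split: prod.splits)

lemma varied_nondeg_dom_subset: "varied_nondeg_dom \<subseteq> varied_dom" by (auto simp: varied_nondeg_dom_def)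

lemma varied_pullback_0: "varied_pullback (0, p) = case_prod Pb p" by (simp add: varied_pullback_def case_prod_beta')

lemma varied_0: "varied (0, p) = case_prod x p" by (simp add: varied_def)

lemma Delta_y: "Delta Theta (y \<epsilon>) t \<xi> = varied_pullback (\<epsilon>, t, \<xi>) - Pb 0 \<xi>"
  by (simp add: Delta_def varied_pullback_def h0)

lemma Delta_dot_y: "(\<epsilon>, t, \<xi>) \<in> varied_dom \<Longrightarrow> Delta_dot Theta (y \<epsilon>) t \<xi> = dd (0, 1, 0) varied_pullback (\<epsilon>, t, \<xi>)"
  using vector_derivative_at[OF dd_vector_derivative[OF smooth_on_varied_pullback, of "(\<epsilon>, 0, \<xi>)" t "(0, 1, 0)"]]
  by (simp add: Delta_dot_def dt_def varied_pullback_def)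

definition varied_state where
  "varied_state q = (snd (snd q), varied_pullback q - Pb 0 (snd (snd q)), dd (0, 1, 0) varied_pullback q)"

text \<open>The integrand of the action in terms of joint directional derivatives, a form smooth in
  \<epsilon>, t and \<xi> together. Agreement with the original integrand is claimed on
  \<open>varied_nondeg_dom\<close> only.\<close>

definition density :: "real \<times> real \<times> (real^'d) \<Rightarrow> real" where
  "density q = (FF (varied_state q) + U (varied q)) * (e (fst (snd q)) * vol (varied_pullback q))"

lemma density_eq:
  "(\<epsilon>, t, \<xi>) \<in> varied_nondeg_dom \<Longrightarrow>
    lagrangian Theta F0 U (y \<epsilon>) t \<xi> * upsilon Theta e (y \<epsilon>) t \<xi> = density (\<epsilon>, t, \<xi>)"
  using varied_nondeg_dom_subset
  by (auto simp: density_def varied_state_def lagrangian_def upsilon_def varpi_def Delta_y Delta_dot_y varied_def varied_pullback_def)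

lemma smooth_on_varied_state: "smooth_on varied_state varied_nondeg_dom"
proof -
  have "smooth_on (\<lambda>q::real \<times> real \<times> (real^'d). (0::real, snd (snd q))) varied_nondeg_dom"
    by (intro smooth_on_Pair smooth_on_const smooth_on_snd smooth_on_ident open_varied_nondeg_dom)
  from smooth_on_compose[OF smooth_on_Pb open_GM open_varied_nondeg_dom this]
  have "smooth_on (\<lambda>q. Pb 0 (snd (snd q))) varied_nondeg_dom" by (auto simp: varied_nondeg_dom_def)
  then show ?thesis
    unfolding varied_state_def
    by (intro smooth_on_Pair smooth_on_diff smooth_on_snd smooth_on_ident open_varied_nondeg_dom
        smooth_on_subset[OF smooth_on_varied_pullback varied_nondeg_dom_subset] smooth_on_dd)
qed

lemma smooth_on_density: "smooth_on density varied_nondeg_dom"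
proof -
  have 1: "smooth_on (\<lambda>q. FF (varied_state q)) varied_nondeg_dom"
    by (rule smooth_on_compose[OF energy(3) open_FF open_varied_nondeg_dom smooth_on_varied_state])
       (auto simp: varied_nondeg_dom_def varied_state_def)
  have 2: "smooth_on (\<lambda>q. U (varied q)) varied_nondeg_dom"
    by (rule smooth_on_compose[OF M(3,1) open_varied_nondeg_dom smooth_on_subset[OF smooth_on_varied_dom varied_nondeg_dom_subset]])
       (auto simp: varied_nondeg_dom_def varied_dom_def)
  have "smooth_on (\<lambda>q::real \<times> real \<times> (real^'d). fst (snd q)) varied_nondeg_dom"
    by (intro smooth_on_fst smooth_on_snd smooth_on_ident open_varied_nondeg_dom)
  from smooth_on_compose[OF metric(3,1) open_varied_nondeg_dom this]
  have 3: "smooth_on (\<lambda>q. e (fst (snd q))) varied_nondeg_dom" by (auto simp: varied_nondeg_dom_def)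
  have 4: "smooth_on (\<lambda>q. vol (varied_pullback q)) varied_nondeg_dom"
    by (rule smooth_on_compose[OF smooth_on_vol open_nondegenerate_tensors open_varied_nondeg_dom
          smooth_on_subset[OF smooth_on_varied_pullback varied_nondeg_dom_subset]]) (auto simp: varied_nondeg_dom_def)
  show ?thesis unfolding density_def by (intro smooth_on_mult smooth_on_add open_varied_nondeg_dom 1 2 3 4)
qed

text \<open>The tube lemma supplies a range of \<epsilon> for which the varied history stays in
  \<open>M\<close> with nondegenerate pullback over all of [0,1] x B. There the action is the
  integral of \<open>density\<close>, which may be differentiated under the integral.\<close>

lemma action_has_derivative:
  "((\<lambda>\<epsilon>. action Theta F0 U e (y \<epsilon>) B) has_real_derivative
     integral ({0..1} \<times> B) (\<lambda>p. dd (1, 0) density (0, p))) (at 0)"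
proof -
  have Z: "compact ({0..1::real} \<times> B)" by (intro compact_Times body) simp
  have sub: "{0} \<times> ({0..1} \<times> B) \<subseteq> varied_nondeg_dom" using W_subset_varied_nondeg_dom Z_subset_W by auto
  obtain S where S: "0 \<in> S" "open S" "S \<times> ({0..1} \<times> B) \<subseteq> varied_nondeg_dom"
    using Elementary_Topology.tube_lemma[OF Z open_varied_nondeg_dom sub] by auto
  show ?thesis
  proof (rule has_field_derivative_transform_within_open[OF _ S(2,1)])
    show "((\<lambda>\<epsilon>. integral ({0..1} \<times> B) (\<lambda>p. density (\<epsilon>, p))) has_real_derivative
        integral ({0..1} \<times> B) (\<lambda>p. dd (1, 0) density (0, p))) (at 0)"
      by (rule has_real_derivative_integral_compact[OF Z open_varied_nondeg_dom sub smooth_on_density])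
    fix \<epsilon> assume "\<epsilon> \<in> S"
    then show "integral ({0..1} \<times> B) (\<lambda>p. density (\<epsilon>, p)) = action Theta F0 U e (y \<epsilon>) B"
      unfolding action_def
      by (intro integral_cong) (use S(3) in \<open>auto simp: subset_iff density_eq\<close>)
  qed
qed

definition theta :: "real \<times> (real^'d) \<Rightarrow> real^('k + 'k \<Rightarrow> 'd)" where
  "theta p = dd (1, 0) varied_pullback (0, p)"

lemma smooth_on_0_slice: "smooth_on F varied_nondeg_dom \<Longrightarrow> smooth_on (\<lambda>p. F (0, p)) W"
  by (rule smooth_on_compose[OF _ open_varied_nondeg_dom open_W])
     (auto intro!: smooth_on_Pair smooth_on_const smooth_on_ident open_W W_subset_varied_nondeg_dom)

lemma smooth_on_theta: "smooth_on theta W"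
  unfolding theta_def
  by (intro smooth_on_0_slice smooth_on_dd smooth_on_subset[OF smooth_on_varied_pullback varied_nondeg_dom_subset])

text \<open>A spatial derivative of \<open>varied\<close> is still affine in \<epsilon>, with slope
  the spatial derivative of h.\<close>

lemma dd_dd_varied: "snd q \<in> G \<Longrightarrow> dd (1, 0) (dd (0, 0, v) varied) q = dd (0, v) (case_prod h) (snd q)"
proof -
  assume q: "snd q \<in> G"
  have "dd (1, 0) (dd (0, 0, v) varied) q =
      dd (1, 0) (\<lambda>q. dd (0, v) (case_prod x) (snd q) + fst q *\<^sub>R dd (0, v) (case_prod h) (snd q)) q"
    using dd_family[OF history(3) h, of _ 0 "(0, v)"] q
    by (intro dd_transform[OF open_snd_G]) (auto simp: varied_def[abs_def])
  also have "\<dots> = dd (0, v) (case_prod h) (snd q)"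
    using dd_family[OF smooth_on_dd[OF history(3), of "(0, v)"] smooth_on_dd[OF h, of "(0, v)"] q, of 1 0]
      linear_0[OF linear_frechet_derivative[OF smooth_on_differentiable[OF smooth_on_dd[OF history(3)] q]]]
      linear_0[OF linear_frechet_derivative[OF smooth_on_differentiable[OF smooth_on_dd[OF h] UNIV_I]]]
    by (simp add: zero_prod_def)
  finally show ?thesis .
qed

lemma dd_varied: "p \<in> G \<Longrightarrow> dd (1, 0) varied (0, p) = case_prod h p"
  using dd_family[OF history(3) h, of "(0, p)" 1 0]
    linear_0[OF linear_frechet_derivative[OF smooth_on_differentiable[OF history(3)]]]
  by (simp add: varied_def[abs_def] zero_prod_def)

lemma dd_varied_space: "p \<in> G \<Longrightarrow> dd (0, 0, v) varied (0, p) = dd (0, v) (case_prod x) p"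
  using dd_family[OF history(3) h, of "(0, p)" 0 "(0, v)"] by (simp add: varied_def[abs_def])

text \<open>\<open>dd_pull\<close> in the direction of \<epsilon>: \<open>Theta\<close> moves along
  h, and the factor of each slot is replaced in turn by a derivative of h.\<close>

lemma theta_eq:
  assumes "(t, \<xi>) \<in> W"
  shows "theta (t, \<xi>) $ a =
    (\<Sum>b\<in>UNIV. dd (h t \<xi>) Theta (x t \<xi>) $ b * (\<Prod>r\<in>UNIV. pd (a r) (x t) \<xi> $ b r)
      + Theta (x t \<xi>) $ b * (\<Sum>s\<in>UNIV. dd (0, axis (a s) 1) (case_prod h) (t, \<xi>) $ b s *
          (\<Prod>r\<in>UNIV - {s}. pd (a r) (x t) \<xi> $ b r)))"
proof -
  have p: "(0, t, \<xi>) \<in> varied_dom" "(t, \<xi>) \<in> G" "(t, \<xi>) \<in> GM"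
    using W_subset_varied_nondeg_dom[OF assms] varied_nondeg_dom_subset assms by (auto simp: W_def GM_def)
  have "theta (t, \<xi>) = dd (1, 0) (pull (\<lambda>v. (0, 0, v)) Theta varied) (0, t, \<xi>)"
    unfolding theta_def by (rule dd_transform[OF open_varied_dom p(1) varied_pullback_eq])
  then show ?thesis
    using p(1) by (simp add: dd_pull[OF open_varied_dom p(1) smooth_on_varied_dom M(2)] varied_dom_def dd_dd_varied
        dd_varied[OF p(2)] dd_varied_space[OF p(2)] pd_x[OF p(3)] varied_def)
qed

end

context elastic_history
begin

abbreviation "Scov \<equiv> Sigma_tensor_cov Theta F0 U e x"

definition motion_defect :: "'n \<Rightarrow> real \<times> (real^'d) \<Rightarrow> real" where
  "motion_defect A p = case_prod (divergence Theta x (upsilon Theta e x) Scov A) p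
     + case_prod (f_Theta Theta x Scov A) p + case_prod (f_ext U x A) p"

lemma smooth_on_motion_defect: "smooth_on (motion_defect A) W1"
  unfolding motion_defect_def
  by (intro smooth_on_add open_W1 smooth_on_divergence smooth_on_f_Theta smooth_on_Sigma_tensor_cov
      W1_subset order_refl smooth_on_subset[OF smooth_on_f_ext W1_subset])

end

section \<open>The derivative of the action density\<close>

context elastic_variation
begin

lemma theta_off_K: "p \<in> W \<Longrightarrow> p \<notin> K \<Longrightarrow> theta p = 0"
proof -
  assume p: "p \<in> W" "p \<notin> K"
  obtain t \<xi> where [simp]: "p = (t, \<xi>)" by (cases p)
  have "x t \<xi> \<in> M" "h t \<xi> = 0" using p K(3) by (auto simp: W_def GM_def)
  then have "dd (h t \<xi>) Theta (x t \<xi>) = 0"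
    using linear_0[OF linear_frechet_derivative[OF smooth_on_differentiable[OF M(2)]]] by simp
  then show ?thesis using p by (simp add: vec_eq_iff theta_eq dd_h_off_K)
qed

text \<open>The chain rule before integration by parts. The strain varies by \<theta>, the velocity
  by its time derivative, the logarithm of the volume by pairing its gradient with \<theta>, and the
  position by h.\<close>

lemma dd_density_eq:
  assumes p: "(t, \<xi>) \<in> W"
  shows "dd (1, 0) density (0, t, \<xi>) = upsilon Theta e x t \<xi> *
    (stress Theta F0 x t \<xi> \<bullet> theta (t, \<xi>) + momentum Theta F0 x t \<xi> \<bullet> dd (1, 0) theta (t, \<xi>)
      + lagrangian Theta F0 U x t \<xi> * (ln_vol_grad Theta x t \<xi> \<bullet> theta (t, \<xi>))
      + dd (h t \<xi>) U (x t \<xi>))"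
proof -
  let ?\<theta> = "theta (t, \<xi>)" and ?\<theta>' = "dd (1, 0) theta (t, \<xi>)"
  have q: "(0, t, \<xi>) \<in> varied_nondeg_dom" "(0, t, \<xi>) \<in> varied_dom" using W_subset_varied_nondeg_dom[OF p] varied_nondeg_dom_subset by auto
  have pW: "(t, \<xi>) \<in> G" "(t, \<xi>) \<in> GM" "\<xi> \<in> N" "x t \<xi> \<in> M" "Pb t \<xi> \<in> nondegenerate_tensors"
    using p by (auto simp: W_def GM_def)
  have line: "((\<lambda>s. F (s, t, \<xi>)) has_derivative (\<lambda>r. r *\<^sub>R dd (1, 0) F (0, t, \<xi>))) (at 0)"
    if "smooth_on F S" "(0, t, \<xi>) \<in> S" for F :: "real \<times> real \<times> (real^'d) \<Rightarrow> 'z::real_normed_vector" and S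
    using dd_vector_derivative[OF that(1), of "(0, t, \<xi>)" 0 "(1, 0)"] that(2)
    by (simp add: has_vector_derivative_def zero_prod_def)
  \<comment> \<open>Symmetry of second derivatives makes the variation of the velocity the time
    derivative of \<theta>.\<close>
  have mixed: "dd (1, 0) (dd (0, 1, 0) varied_pullback) (0, t, \<xi>) = ?\<theta>'"
  proof -
    have "dd (1, 0) (dd (0, 1, 0) varied_pullback) (0, t, \<xi>) = dd (0, 1, 0) (dd (1, 0) varied_pullback) (0, t, \<xi>)"
      by (rule dd_commute[OF open_varied_dom q(2) smooth_on_varied_pullback])
    also have "\<dots> = dd (1, 0) (\<lambda>p. dd (1, 0) varied_pullback (0, p)) (t, \<xi>)"
      by (subst dd_compose[of "dd (1, 0) varied_pullback" "\<lambda>p. (0, p)" "(t, \<xi>)" "\<lambda>v. (0, v)"])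
         (use smooth_on_differentiable[OF smooth_on_dd[OF smooth_on_varied_pullback] q(2)] in
           \<open>auto intro!: derivative_eq_intros\<close>)
    finally show ?thesis by (simp add: theta_def[abs_def])
  qed
  note dPE = line[OF smooth_on_varied_pullback q(2), folded theta_def]
  have dV: "((\<lambda>s. dd (0, 1, 0) varied_pullback (s, t, \<xi>)) has_derivative (\<lambda>r. r *\<^sub>R ?\<theta>')) (at 0)"
    using line[OF smooth_on_dd[OF smooth_on_varied_pullback, of "(0, 1, 0)"] q(2)] mixed by simp
  have df: "((\<lambda>s. varied (s, t, \<xi>)) has_derivative (\<lambda>r. r *\<^sub>R h t \<xi>)) (at 0)"
    using line[OF smooth_on_varied_dom q(2)] dd_varied[OF pW(1)] by simp
  have st: "varied_state (0, t, \<xi>) = (\<xi>, Delta Theta x t \<xi>, Delta_dot Theta x t \<xi>)"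
    using Delta_dot_y[OF q(2)] by (simp add: varied_state_def varied_pullback_0 Delta_def)
  have "((\<lambda>s. varied_state (s, t, \<xi>)) has_derivative (\<lambda>r. (0, r *\<^sub>R ?\<theta> - 0, r *\<^sub>R ?\<theta>'))) (at 0)"
    unfolding varied_state_def snd_conv
    by (intro has_derivative_Pair has_derivative_diff has_derivative_const dPE dV)
  from has_derivative_compose[OF this, of FF] FF_differentiable[OF pW(3)] st
  have dF: "((\<lambda>s. FF (varied_state (s, t, \<xi>))) has_derivative
      (\<lambda>r. dd (0, r *\<^sub>R ?\<theta>, r *\<^sub>R ?\<theta>') FF (varied_state (0, t, \<xi>)))) (at 0)"
    by (simp only: st frechet_derivative_works diff_zero)
  have dU: "((\<lambda>s. U (varied (s, t, \<xi>))) has_derivative (\<lambda>r. dd (r *\<^sub>R h t \<xi>) U (varied (0, t, \<xi>)))) (at 0)"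
    using has_derivative_compose[OF df, of U] smooth_on_has_derivative[OF M(3) pW(4)] varied_0[of "(t, \<xi>)"]
    by simp
  have dvol: "((\<lambda>s. vol (varied_pullback (s, t, \<xi>))) has_derivative (\<lambda>r. dd (r *\<^sub>R ?\<theta>) vol (varied_pullback (0, t, \<xi>)))) (at 0)"
    using has_derivative_compose[OF dPE, of vol] smooth_on_has_derivative[OF smooth_on_vol pW(5)]
      varied_pullback_0[of "(t, \<xi>)"] by simp
  have "((\<lambda>s. density (s, t, \<xi>)) has_derivative (\<lambda>r.
      (FF (varied_state (0, t, \<xi>)) + U (varied (0, t, \<xi>))) * (e t * dd (r *\<^sub>R ?\<theta>) vol (varied_pullback (0, t, \<xi>))) +
      (dd (0, r *\<^sub>R ?\<theta>, r *\<^sub>R ?\<theta>') FF (varied_state (0, t, \<xi>)) + dd (r *\<^sub>R h t \<xi>) U (varied (0, t, \<xi>)))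
        * (e t * vol (varied_pullback (0, t, \<xi>))))) (at 0)"
    unfolding density_def fst_conv snd_conv
    by (intro has_derivative_mult has_derivative_add has_derivative_mult_right dF dU dvol)
  from has_derivative_unique[OF line[OF smooth_on_density q(1)] this, THEN fun_cong, of 1]
  have D: "dd (1, 0) density (0, t, \<xi>) =
      (FF (varied_state (0, t, \<xi>)) + U (x t \<xi>)) * (e t * dd ?\<theta> vol (Pb t \<xi>)) +
      (dd (0, ?\<theta>, ?\<theta>') FF (varied_state (0, t, \<xi>)) + dd (h t \<xi>) U (x t \<xi>)) * (e t * vol (Pb t \<xi>))"
    by (simp add: varied_0 varied_pullback_0)
  \<comment> \<open>Linearity splits the joint variation of strain and velocity into the part seen
    by \<open>stress\<close> and the part seen by \<open>momentum\<close>.\<close>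
  have lin: "linear (frechet_derivative FF (at (\<xi>, D, V)))" for D V
    using linear_frechet_derivative FF_differentiable[OF pW(3)] by blast
  have "dd (0, ?\<theta>, ?\<theta>') FF (varied_state (0, t, \<xi>)) =
      dd (0, ?\<theta>, 0) FF (varied_state (0, t, \<xi>)) + dd (0, 0, ?\<theta>') FF (varied_state (0, t, \<xi>))"
    using linear_add[OF lin, of _ _ "(0, ?\<theta>, 0)" "(0, 0, ?\<theta>')"] unfolding st by simp
  also have "\<dots> = stress Theta F0 x t \<xi> \<bullet> ?\<theta> + momentum Theta F0 x t \<xi> \<bullet> ?\<theta>'"
    unfolding st stress_def momentum_def
    using pW(3) by (simp add: inner_grad slice_D slice_V dd_slice_D dd_slice_V)
  finally have 1: "dd (0, ?\<theta>, ?\<theta>') FF (varied_state (0, t, \<xi>)) =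
      stress Theta F0 x t \<xi> \<bullet> ?\<theta> + momentum Theta F0 x t \<xi> \<bullet> ?\<theta>'" .
  have 2: "dd ?\<theta> vol (Pb t \<xi>) = vol (Pb t \<xi>) * (ln_vol_grad Theta x t \<xi> \<bullet> ?\<theta>)"
    using varpi_pos[OF p] smooth_on_differentiable[OF smooth_on_vol pW(5)]
    by (simp add: ln_vol_grad_eq[OF p] varpi_def inner_grad)
  have 3: "FF (varied_state (0, t, \<xi>)) + U (x t \<xi>) = lagrangian Theta F0 U x t \<xi>"
    unfolding st by (simp add: lagrangian_def)
  show ?thesis unfolding D 1 2 3 upsilon_def varpi_def by (simp add: algebra_simps)
qed

text \<open>This is \<open>upsilon\<close> times the pairing of \<pi> with \<theta>. The factor
  \<open>e\<close> is attached to \<pi> so that differentiation in time produces the covariant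
  derivative.\<close>

definition time_flux :: "real \<times> (real^'d) \<Rightarrow> real" where
  "time_flux p = case_prod (varpi Theta x) p * (weighted_momentum p \<bullet> theta p)"

lemma smooth_on_time_flux: "smooth_on time_flux W"
  unfolding time_flux_def
  by (intro smooth_on_mult smooth_on_inner open_W smooth_on_varpi smooth_on_weighted_momentum smooth_on_theta)

text \<open>The first summand, from the growth of the volume with the velocity, is the origin of the
  momentum term of \<open>T_hat\<close>.\<close>

lemma dd_time_flux:
  assumes p: "(t, \<xi>) \<in> W"
  shows "dd (1, 0) time_flux (t, \<xi>) =
    varpi Theta x t \<xi> * (ln_vol_grad Theta x t \<xi> \<bullet> Delta_dot Theta x t \<xi>) * (weighted_momentum (t, \<xi>) \<bullet> theta (t, \<xi>))
    + varpi Theta x t \<xi> * (dd (1, 0) weighted_momentum (t, \<xi>) \<bullet> theta (t, \<xi>)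
        + weighted_momentum (t, \<xi>) \<bullet> dd (1, 0) theta (t, \<xi>))"
proof -
  have pW: "(t, \<xi>) \<in> GM" "Pb t \<xi> \<in> nondegenerate_tensors" using p by (auto simp: W_def)
  note vol' = smooth_on_differentiable[OF smooth_on_vol pW(2)]
  have "dd (1, 0) (case_prod (varpi Theta x)) (t, \<xi>) = dd (1, 0) (\<lambda>p. vol (case_prod Pb p)) (t, \<xi>)"
    by (simp add: varpi_def case_prod_beta')
  also have "\<dots> = dd (Delta_dot Theta x t \<xi>) vol (Pb t \<xi>)"
    using dd_compose[of vol "case_prod Pb" "(t, \<xi>)"] vol' smooth_on_has_derivative[OF smooth_on_Pb pW(1)]
    by (simp add: Delta_dot_eq[OF pW(1)])
  also have "\<dots> = varpi Theta x t \<xi> * (ln_vol_grad Theta x t \<xi> \<bullet> Delta_dot Theta x t \<xi>)"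
    using varpi_pos[OF p] vol' by (simp add: ln_vol_grad_eq[OF p] varpi_def inner_grad)
  finally have 1: "dd (1, 0) (case_prod (varpi Theta x)) (t, \<xi>) =
    varpi Theta x t \<xi> * (ln_vol_grad Theta x t \<xi> \<bullet> Delta_dot Theta x t \<xi>)" .
  have "(time_flux has_derivative (\<lambda>v. case_prod (varpi Theta x) (t, \<xi>) *
        (weighted_momentum (t, \<xi>) \<bullet> dd v theta (t, \<xi>) + dd v weighted_momentum (t, \<xi>) \<bullet> theta (t, \<xi>))
      + dd v (case_prod (varpi Theta x)) (t, \<xi>) * (weighted_momentum (t, \<xi>) \<bullet> theta (t, \<xi>)))) (at (t, \<xi>))"
    unfolding time_flux_def
    by (intro has_derivative_mult has_derivative_inner
        smooth_on_has_derivative[OF smooth_on_varpi p]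
        smooth_on_has_derivative[OF smooth_on_weighted_momentum p]
        smooth_on_has_derivative[OF smooth_on_theta p])
  from dd_eqI[OF this, of "(1, 0)"] show ?thesis by (simp add: 1)
qed

text \<open>The derivative of \<open>time_flux\<close> absorbs the pairing of \<pi> with the time
  derivative of \<theta>. What remains is linear in \<theta> itself, and its coefficient collects
  into the covariant stress tensor.\<close>

lemma dd_density_eq_Sigma:
  assumes p: "(t, \<xi>) \<in> W1"
  shows "dd (1, 0) density (0, t, \<xi>) = upsilon Theta e x t \<xi> *
      (Sigma_tensor_cov Theta F0 U e x t \<xi> \<bullet> theta (t, \<xi>) + dd (h t \<xi>) U (x t \<xi>))
    + dd (1, 0) time_flux (t, \<xi>)"
proof -
  have pW: "(t, \<xi>) \<in> W" "e t > 0" using p by (auto simp: W1_def)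
  show ?thesis
    unfolding dd_density_eq[OF pW(1)] dd_time_flux[OF pW(1)] Sigma_tensor_cov_def T_hat_def
      dt_weighted_momentum[OF pW(1)] upsilon_def weighted_momentum_def
    using pW(2) by (simp add: inner_diff_left inner_simps field_simps)
qed

text \<open>Contraction of \<open>theta_eq\<close> with an arbitrary S: the part where
  \<open>Theta\<close> moves yields the force, with its built-in minus sign, and the slot terms
  regroup into \<open>Sigma_tilde\<close> against derivatives of h.\<close>

lemma Sigma_inner_theta:
  assumes p: "(t, \<xi>) \<in> W"
  shows "S t \<xi> \<bullet> theta (t, \<xi>) = (\<Sum>A\<in>UNIV. - f_Theta Theta x S A t \<xi> * h t \<xi> $ A) +
    (\<Sum>A\<in>UNIV. \<Sum>\<alpha>\<in>UNIV. Sigma_tilde Theta x S \<alpha> A t \<xi> * dd (0, axis \<alpha> 1) (case_prod h) (t, \<xi>) $ A)"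
proof -
  define D where "D \<alpha> = dd (0, axis \<alpha> 1) (case_prod h) (t, \<xi>)" for \<alpha>
  define Q where "Q a b = (\<Prod>r\<in>UNIV. pd (a r) (x t) \<xi> $ b r)" for a :: "'k + 'k \<Rightarrow> 'd" and b
  define R where "R s a b = S t \<xi> $ a * Theta (x t \<xi>) $ b * (\<Prod>r\<in>UNIV - {s}. pd (a r) (x t) \<xi> $ b r)"
    for s and a :: "'k + 'k \<Rightarrow> 'd" and b
  have "x t \<xi> \<in> M" using p by (auto simp: W_def GM_def)
  then have T: "dd (h t \<xi>) Theta (x t \<xi>) $ b = (\<Sum>A\<in>UNIV. h t \<xi> $ A * pd A Theta (x t \<xi>) $ b)" for b
    using dd_eq_sum_pd[OF smooth_on_differentiable[OF M(2)], of "x t \<xi>" "h t \<xi>"] by simp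
  have "S t \<xi> \<bullet> theta (t, \<xi>) =
      (\<Sum>a\<in>UNIV. \<Sum>b\<in>UNIV. S t \<xi> $ a * (\<Sum>A\<in>UNIV. h t \<xi> $ A * pd A Theta (x t \<xi>) $ b) * Q a b) +
      (\<Sum>a\<in>UNIV. \<Sum>b\<in>UNIV. \<Sum>s\<in>UNIV. R s a b * D (a s) $ b s)"
    by (simp add: inner_vec_def theta_eq[OF p] T Q_def R_def D_def sum.distrib sum_distrib_left
        distrib_left mult_ac)
  also have "(\<Sum>a\<in>UNIV. \<Sum>b\<in>UNIV. S t \<xi> $ a * (\<Sum>A\<in>UNIV. h t \<xi> $ A * pd A Theta (x t \<xi>) $ b) * Q a b) =
      (\<Sum>a\<in>UNIV. \<Sum>b\<in>UNIV. \<Sum>A\<in>UNIV. S t \<xi> $ a * pd A Theta (x t \<xi>) $ b * Q a b * h t \<xi> $ A)"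
    by (simp add: sum_distrib_left sum_distrib_right mult_ac)
  also have "\<dots> = (\<Sum>a\<in>UNIV. \<Sum>A\<in>UNIV. \<Sum>b\<in>UNIV. S t \<xi> $ a * pd A Theta (x t \<xi>) $ b * Q a b * h t \<xi> $ A)"
    by (intro sum.cong refl sum.swap)
  also have "\<dots> = (\<Sum>A\<in>UNIV. \<Sum>a\<in>UNIV. \<Sum>b\<in>UNIV. S t \<xi> $ a * pd A Theta (x t \<xi>) $ b * Q a b * h t \<xi> $ A)"
    by (rule sum.swap)
  also have "\<dots> = (\<Sum>A\<in>UNIV. - f_Theta Theta x S A t \<xi> * h t \<xi> $ A)"
    by (simp add: f_Theta_def Q_def sum_distrib_right)
  \<comment> \<open>The slot s is moved outermost; for fixed s the multi-indices a and b are then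
    sorted by their entries \<alpha> and A in that slot.\<close>
  also have "(\<Sum>a\<in>UNIV. \<Sum>b\<in>UNIV. \<Sum>s\<in>UNIV. R s a b * D (a s) $ b s) =
      (\<Sum>a\<in>UNIV. \<Sum>s\<in>UNIV. \<Sum>b\<in>UNIV. R s a b * D (a s) $ b s)"
    by (intro sum.cong refl sum.swap)
  also have "\<dots> = (\<Sum>s\<in>UNIV. \<Sum>a\<in>UNIV. \<Sum>b\<in>UNIV. R s a b * D (a s) $ b s)"
    by (rule sum.swap)
  also have "\<dots> = (\<Sum>s\<in>UNIV. \<Sum>\<alpha>\<in>UNIV. \<Sum>a | a s = \<alpha>. \<Sum>A\<in>UNIV. \<Sum>b | b s = A. R s a b * D \<alpha> $ A)"
    by (simp add: sum_over_fibres)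
  also have "\<dots> = (\<Sum>s\<in>UNIV. \<Sum>\<alpha>\<in>UNIV. \<Sum>A\<in>UNIV. \<Sum>a | a s = \<alpha>. \<Sum>b | b s = A. R s a b * D \<alpha> $ A)"
    by (intro sum.cong refl sum.swap)
  also have "\<dots> = (\<Sum>s\<in>UNIV. \<Sum>A\<in>UNIV. \<Sum>\<alpha>\<in>UNIV. \<Sum>a | a s = \<alpha>. \<Sum>b | b s = A. R s a b * D \<alpha> $ A)"
    by (intro sum.cong refl sum.swap)
  also have "\<dots> = (\<Sum>A\<in>UNIV. \<Sum>s\<in>UNIV. \<Sum>\<alpha>\<in>UNIV. \<Sum>a | a s = \<alpha>. \<Sum>b | b s = A. R s a b * D \<alpha> $ A)"
    by (rule sum.swap)
  also have "\<dots> = (\<Sum>A\<in>UNIV. \<Sum>\<alpha>\<in>UNIV. \<Sum>s\<in>UNIV. \<Sum>a | a s = \<alpha>. \<Sum>b | b s = A. R s a b * D \<alpha> $ A)"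
    by (intro sum.cong refl sum.swap)
  also have "\<dots> = (\<Sum>A\<in>UNIV. \<Sum>\<alpha>\<in>UNIV. Sigma_tilde Theta x S \<alpha> A t \<xi> * D \<alpha> $ A)"
    by (simp add: Sigma_tilde_def R_def sum_distrib_right)
  finally show ?thesis by (simp add: D_def)
qed

section \<open>Integration by parts over the body\<close>

definition flux :: "'d \<Rightarrow> 'n \<Rightarrow> real \<times> (real^'d) \<Rightarrow> real" where
  "flux \<alpha> A p = case_prod (upsilon Theta e x) p * case_prod (Sigma_tilde Theta x Scov \<alpha> A) p"

lemma smooth_on_flux: "smooth_on (flux \<alpha> A) W1"
  unfolding flux_def
  by (intro smooth_on_mult open_W1 smooth_on_subset[OF smooth_on_upsilon W1_subset]
      smooth_on_Sigma_tilde W1_subset smooth_on_Sigma_tensor_cov)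

definition body_flux :: "'d \<Rightarrow> real \<times> (real^'d) \<Rightarrow> real" where
  "body_flux \<alpha> p = (\<Sum>A\<in>UNIV. flux \<alpha> A p * case_prod h p $ A)"

lemma smooth_on_h: "open S \<Longrightarrow> smooth_on (\<lambda>p. case_prod h p $ A) S"
  by (intro smooth_on_vec_nth smooth_on_subset[OF h]) auto

lemma smooth_on_body_flux: "smooth_on (body_flux \<alpha>) W1"
  unfolding body_flux_def by (intro smooth_on_sum smooth_on_mult open_W1 smooth_on_flux smooth_on_h)

text \<open>The Leibniz rule trades derivatives of h for h: derivatives of \<open>flux\<close>
  assemble into \<open>upsilon\<close> times the divergence, and derivatives of h reproduce the slot
  terms of \<open>Sigma_inner_theta\<close>.\<close>

lemma sum_dd_body_flux:
  assumes p: "(t, \<xi>) \<in> W1"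
  shows "(\<Sum>\<alpha>\<in>UNIV. dd (0, axis \<alpha> 1) (body_flux \<alpha>) (t, \<xi>)) =
    upsilon Theta e x t \<xi> * ((\<Sum>A\<in>UNIV. divergence Theta x (upsilon Theta e x) Scov A t \<xi> * h t \<xi> $ A) +
    (\<Sum>A\<in>UNIV. \<Sum>\<alpha>\<in>UNIV. Sigma_tilde Theta x Scov \<alpha> A t \<xi> * dd (0, axis \<alpha> 1) (case_prod h) (t, \<xi>) $ A))"
proof -
  have u: "upsilon Theta e x t \<xi> \<noteq> 0" using upsilon_pos[OF p] by simp
  have hd: "case_prod h differentiable (at (t, \<xi>))" using smooth_on_differentiable[OF h] by simp
  have "dd v (body_flux \<alpha>) (t, \<xi>) = (\<Sum>A\<in>UNIV. flux \<alpha> A (t, \<xi>) * dd v (case_prod h) (t, \<xi>) $ A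
      + dd v (flux \<alpha> A) (t, \<xi>) * h t \<xi> $ A)" for v \<alpha>
  proof -
    have "(body_flux \<alpha> has_derivative (\<lambda>v. \<Sum>A\<in>UNIV. flux \<alpha> A (t, \<xi>) * dd v (\<lambda>p. case_prod h p $ A) (t, \<xi>)
        + dd v (flux \<alpha> A) (t, \<xi>) * case_prod h (t, \<xi>) $ A)) (at (t, \<xi>))"
      unfolding body_flux_def
      by (intro has_derivative_sum has_derivative_mult smooth_on_has_derivative[OF smooth_on_flux p]
          smooth_on_has_derivative[OF smooth_on_h[OF open_UNIV] UNIV_I])
    from dd_eqI[OF this, of v] show ?thesis by (simp add: dd_vec_nth[OF hd])
  qed
  then have "(\<Sum>\<alpha>\<in>UNIV. dd (0, axis \<alpha> 1) (body_flux \<alpha>) (t, \<xi>)) =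
      (\<Sum>\<alpha>\<in>UNIV. \<Sum>A\<in>UNIV. flux \<alpha> A (t, \<xi>) * dd (0, axis \<alpha> 1) (case_prod h) (t, \<xi>) $ A)
      + (\<Sum>\<alpha>\<in>UNIV. \<Sum>A\<in>UNIV. dd (0, axis \<alpha> 1) (flux \<alpha> A) (t, \<xi>) * h t \<xi> $ A)"
    by (simp add: sum.distrib)
  also have "(\<Sum>\<alpha>\<in>UNIV. \<Sum>A\<in>UNIV. flux \<alpha> A (t, \<xi>) * dd (0, axis \<alpha> 1) (case_prod h) (t, \<xi>) $ A) =
      (\<Sum>A\<in>UNIV. \<Sum>\<alpha>\<in>UNIV. flux \<alpha> A (t, \<xi>) * dd (0, axis \<alpha> 1) (case_prod h) (t, \<xi>) $ A)"
    by (rule sum.swap)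
  also have "\<dots> = upsilon Theta e x t \<xi> * (\<Sum>A\<in>UNIV. \<Sum>\<alpha>\<in>UNIV. Sigma_tilde Theta x Scov \<alpha> A t \<xi> *
      dd (0, axis \<alpha> 1) (case_prod h) (t, \<xi>) $ A)"
    by (simp add: flux_def sum_distrib_left mult.assoc)
  also have "(\<Sum>\<alpha>\<in>UNIV. \<Sum>A\<in>UNIV. dd (0, axis \<alpha> 1) (flux \<alpha> A) (t, \<xi>) * h t \<xi> $ A) =
      (\<Sum>A\<in>UNIV. \<Sum>\<alpha>\<in>UNIV. dd (0, axis \<alpha> 1) (flux \<alpha> A) (t, \<xi>) * h t \<xi> $ A)"
    by (rule sum.swap)
  also have "\<dots> = (\<Sum>A\<in>UNIV. upsilon Theta e x t \<xi> * divergence Theta x (upsilon Theta e x) Scov A t \<xi> * h t \<xi> $ A)"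
  proof (rule sum.cong[OF refl])
    fix A
    have "upsilon Theta e x t \<xi> * divergence Theta x (upsilon Theta e x) Scov A t \<xi> =
        (\<Sum>\<alpha>\<in>UNIV. dd (0, axis \<alpha> 1) (flux \<alpha> A) (t, \<xi>))"
      using u pd_weighted_Sigma_tilde[OF open_W1 smooth_on_subset[OF smooth_on_upsilon W1_subset]
          smooth_on_Sigma_tilde[OF open_W1 W1_subset smooth_on_Sigma_tensor_cov] p]
      by (simp add: divergence_def flux_def[abs_def])
    then show "(\<Sum>\<alpha>\<in>UNIV. dd (0, axis \<alpha> 1) (flux \<alpha> A) (t, \<xi>) * h t \<xi> $ A) =
        upsilon Theta e x t \<xi> * divergence Theta x (upsilon Theta e x) Scov A t \<xi> * h t \<xi> $ A"
      by (simp add: sum_distrib_right)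
  qed
  finally show ?thesis by (simp add: sum_distrib_left distrib_left mult.assoc)
qed

text \<open>All three terms of \<open>motion_defect\<close> enter with a minus sign: the divergence
  from the trade of derivatives, the two forces from the signs in their definitions.\<close>

lemma first_variation_density:
  assumes p: "p \<in> W1"
  shows "dd (1, 0) density (0, p) =
    - (case_prod (upsilon Theta e x) p * (\<Sum>A\<in>UNIV. motion_defect A p * case_prod h p $ A))
    + (dd (1, 0) time_flux p + (\<Sum>\<alpha>\<in>UNIV. dd (0, axis \<alpha> 1) (body_flux \<alpha>) p))"
proof -
  obtain t \<xi> where [simp]: "p = (t, \<xi>)" by (cases p)
  have pW: "(t, \<xi>) \<in> W1" "(t, \<xi>) \<in> W" "x t \<xi> \<in> M" using p by (auto simp: W1_def W_def GM_def)
  have "dd (h t \<xi>) U (x t \<xi>) = (\<Sum>A\<in>UNIV. - f_ext U x A t \<xi> * h t \<xi> $ A)"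
    using dd_eq_sum_pd[OF smooth_on_differentiable[OF M(3) pW(3)], of "h t \<xi>"]
    by (simp add: f_ext_def mult.commute)
  then show ?thesis
    by (simp add: dd_density_eq_Sigma[OF pW(1)] Sigma_inner_theta[OF pW(2)] sum_dd_body_flux[OF pW(1)] motion_defect_def
        distrib_right sum.distrib sum_negf distrib_left right_diff_distrib)
qed

text \<open>Both fluxes vanish off K, \<open>time_flux\<close> through \<theta> and
  \<open>body_flux\<close> through h, so their derivatives integrate to zero.\<close>

lemma first_variation:
  "((\<lambda>\<epsilon>. action Theta F0 U e (y \<epsilon>) B) has_real_derivative
     - integral ({0..1} \<times> B) (\<lambda>p. case_prod (upsilon Theta e x) p * (\<Sum>A\<in>UNIV. motion_defect A p * case_prod h p $ A))) (at 0)"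
proof -
  let ?Z = "{0..1::real} \<times> B"
  let ?g = "\<lambda>p. case_prod (upsilon Theta e x) p * (\<Sum>A\<in>UNIV. motion_defect A p * case_prod h p $ A)"
  have Z: "compact ?Z" by (intro compact_Times body) simp
  have KZ: "K \<subseteq> ?Z"
    using K(2) interior_subset[of B] by force
  have int: "F integrable_on ?Z" if "smooth_on F W1" for F :: "real \<times> (real^'d) \<Rightarrow> real"
    using Z smooth_on_continuous[OF that] Z_subset_W1
    by (intro continuous_on_compact_integrable) (auto intro: continuous_on_subset)
  have g: "smooth_on ?g W1"
    by (intro smooth_on_mult smooth_on_sum open_W1 smooth_on_motion_defect smooth_on_h
        smooth_on_subset[OF smooth_on_upsilon W1_subset])
  have dV0: "smooth_on (dd (1, 0) time_flux) W1"
    by (rule smooth_on_subset[OF smooth_on_dd[OF smooth_on_time_flux] W1_subset])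
  have dV1: "smooth_on (dd v (body_flux \<alpha>)) W1" for v \<alpha> by (rule smooth_on_dd[OF smooth_on_body_flux])
  have "integral ?Z (dd (1, 0) time_flux) = 0"
    by (rule integral_dd_eq_0[OF open_W Z_subset_W smooth_on_time_flux K(1) KZ]) (simp add: time_flux_def theta_off_K)
  moreover have "integral ?Z (dd v (body_flux \<alpha>)) = 0" for v \<alpha>
    by (rule integral_dd_eq_0[OF open_W1 Z_subset_W1 smooth_on_body_flux K(1) KZ]) (simp add: body_flux_def off_K)
  moreover have "integral ?Z (\<lambda>p. dd (1, 0) density (0, p)) =
      integral ?Z (\<lambda>p. - ?g p + (dd (1, 0) time_flux p + (\<Sum>\<alpha>\<in>UNIV. dd (0, axis \<alpha> 1) (body_flux \<alpha>) p)))"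
    by (rule integral_cong, rule first_variation_density) (use Z_subset_W1 in blast)
  moreover have "\<dots> = - integral ?Z ?g + (integral ?Z (dd (1, 0) time_flux)
      + (\<Sum>\<alpha>\<in>UNIV. integral ?Z (dd (0, axis \<alpha> 1) (body_flux \<alpha>))))"
    by (intro integral_unique has_integral_add has_integral_neg has_integral_sum integrable_integral
        finite_class.finite_UNIV int g dV0 dV1)
  ultimately have "integral ?Z (\<lambda>p. dd (1, 0) density (0, p)) = - integral ?Z ?g" by simp
  then show ?thesis using action_has_derivative by simp
qed

end

section \<open>Extremality and the equations of motion\<close>

context elastic_history
begin

lemma elastic_variation_intro:
  assumes "smooth_on (case_prod h) UNIV" "compact K" "K \<subseteq> {0<..<1} \<times> interior B"
    "\<And>t \<xi>. (t, \<xi>) \<notin> K \<Longrightarrow> h t \<xi> = 0"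
  shows "elastic_variation Theta F0 U e x M B N G J h K"
  using elastic_history_axioms assms by (intro elastic_variation.intro elastic_variation_axioms.intro)

text \<open>One direction is read off \<open>first_variation\<close>. The other applies the
  fundamental lemma to \<open>upsilon\<close> times the defect and divides by the positive
  weight.\<close>

lemma extremal_iff_motion_defect: "extremal Theta F0 U e B x \<longleftrightarrow> (\<forall>A. \<forall>p\<in>{0..1} \<times> B. motion_defect A p = 0)"
proof
  let ?Z = "{0..1::real} \<times> B"
  assume ext: "extremal Theta F0 U e B x"
  \<comment> \<open>With this interior, test functions of the fundamental lemma have exactly the
    supports that \<open>variations\<close> admits.\<close>
  have Z: "compact ?Z" "closure (interior ?Z) = ?Z" and int: "interior ?Z = {0<..<1} \<times> interior B"
    using body by (auto simp: interior_Times closure_Times intro!: compact_Times)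
  show "\<forall>A. \<forall>p\<in>?Z. motion_defect A p = 0"
  proof (intro allI ballI)
    fix A p assume p: "p \<in> ?Z"
    let ?E = "\<lambda>p. case_prod (upsilon Theta e x) p * motion_defect A p"
    have "smooth_on ?E W1"
      by (intro smooth_on_mult open_W1 smooth_on_motion_defect smooth_on_subset[OF smooth_on_upsilon W1_subset])
    then have "continuous_on ?Z ?E"
      using smooth_on_continuous continuous_on_subset Z_subset_W1 by blast
    then have "?E p = 0"
    proof (rule fundamental_lemma_calculus_of_variations[OF Z _ _ p])
      fix \<phi> :: "real \<times> (real^'d) \<Rightarrow> real" and K
      assume \<phi>: "smooth_on \<phi> UNIV" "compact K" "K \<subseteq> interior ?Z" "\<And>p. p \<notin> K \<Longrightarrow> \<phi> p = 0"
      \<comment> \<open>A scalar test function along one coordinate axis isolates the component A of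
        the defect.\<close>
      define h where "h t \<xi> = \<phi> (t, \<xi>) *\<^sub>R (axis A 1 :: real^'n)" for t \<xi>
      have "smooth_on (\<lambda>p. \<phi> p *\<^sub>R (axis A 1 :: real^'n)) UNIV"
        by (intro smooth_on_scaleR smooth_on_const \<phi> open_UNIV)
      then have h: "smooth_on (case_prod h) UNIV" by (simp add: h_def case_prod_beta')
      interpret V: elastic_variation Theta F0 U e x M B N G J h K
        by (rule elastic_variation_intro[OF h \<phi>(2)]) (use \<phi> int h_def in auto)
      have "h \<in> variations B"
        unfolding variations_def using h \<phi>(2-4) int by (auto simp: h_def)
      then have "((\<lambda>\<epsilon>. action Theta F0 U e (\<lambda>t \<xi>. x t \<xi> + \<epsilon> *\<^sub>R h t \<xi>) B) has_real_derivative 0) (at 0)"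
        using ext by (simp add: extremal_def)
      from DERIV_unique[OF V.first_variation this]
      have "integral ?Z (\<lambda>p. case_prod (upsilon Theta e x) p *
          (\<Sum>A'\<in>UNIV. motion_defect A' p * case_prod h p $ A')) = 0" by simp
      moreover have "(\<Sum>A'\<in>UNIV. motion_defect A' p * case_prod h p $ A') = motion_defect A p * \<phi> p" for p
        by (simp add: h_def case_prod_beta' axis_def if_distrib cong: if_cong)
      ultimately show "integral ?Z (\<lambda>p. ?E p * \<phi> p) = 0" by (simp add: mult.assoc)
    qed
    moreover have "case_prod (upsilon Theta e x) p > 0"
      using subsetD[OF Z_subset_W1 p] upsilon_pos by (cases p) auto
    ultimately show "motion_defect A p = 0" by simp
  qed
next
  assume motion_defect: "\<forall>A. \<forall>p\<in>{0..1} \<times> B. motion_defect A p = 0"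
  show "extremal Theta F0 U e B x"
    unfolding extremal_def
  proof
    fix h :: "real \<Rightarrow> real^'d \<Rightarrow> real^'n" assume "h \<in> variations B"
    then obtain K where h: "smooth_on (case_prod h) UNIV" and K: "compact K" "K \<subseteq> {0<..<1} \<times> interior B"
        "\<And>t \<xi>. (t, \<xi>) \<notin> K \<Longrightarrow> h t \<xi> = 0"
      unfolding variations_def by auto
    interpret V: elastic_variation Theta F0 U e x M B N G J h K
      by (rule elastic_variation_intro[OF h K])
    have "integral ({0..1} \<times> B) (\<lambda>p. case_prod (upsilon Theta e x) p *
        (\<Sum>A\<in>UNIV. motion_defect A p * case_prod h p $ A)) = integral ({0..1::real} \<times> B) (\<lambda>_. 0)"
    proof (rule integral_cong)
      fix p assume "p \<in> {0..1::real} \<times> B"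
      then have "motion_defect A p = 0" for A using motion_defect by blast
      then show "case_prod (upsilon Theta e x) p * (\<Sum>A\<in>UNIV. motion_defect A p * case_prod h p $ A) = 0"
        by simp
    qed
    then show "((\<lambda>\<epsilon>. action Theta F0 U e (\<lambda>t \<xi>. x t \<xi> + \<epsilon> *\<^sub>R h t \<xi>) B) has_real_derivative 0) (at 0)"
      using V.first_variation by simp
  qed
qed

lemma equations_of_motion_cov_iff:
  "equations_of_motion Theta U e x B Scov \<longleftrightarrow> (\<forall>A. \<forall>p\<in>{0..1} \<times> B. motion_defect A p = 0)"
  by (auto simp: equations_of_motion_def motion_defect_def)

text \<open>With vanishing derivative of \<open>e\<close>, the factor \<open>e t\<close> leaves the
  time derivative and cancels against \<open>1 / e t\<close>.\<close>

lemma Sigma_tensor_eq_cov: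
  assumes e: "\<forall>t\<in>{0..1}. e t = e 0" and t: "t \<in> {0..1}" and p: "(t, \<xi>) \<in> W1"
  shows "Sigma_tensor Theta F0 U x t \<xi> = Scov t \<xi>"
proof -
  have pW: "(t, \<xi>) \<in> W" "e t > 0" using p by (auto simp: W1_def)
  let ?m = "\<lambda>s. momentum Theta F0 x s \<xi>"
  have m: "(?m has_vector_derivative dt ?m t) (at t)"
    using dd_vector_derivative[OF smooth_on_momentum, of "(0, \<xi>)" t "(1, 0)"] pW(1) dt_momentum[OF pW(1)]
    by simp
  obtain D where D: "(e has_real_derivative D) (at t)"
    using smooth_on_differentiable[OF metric(3) subsetD[OF metric(2) t]]
    by (auto simp: real_differentiable_def)
  \<comment> \<open>\<open>e\<close> is constant on [0,1] only, while \<open>dt\<close> is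
    two-sided. As the two-sided derivative exists, it equals the derivative within the interval,
    which settles the endpoints too.\<close>
  have "D = 0"
  proof (rule vector_derivative_unique_within_closed_interval[of 0 1 t e])
    show "(e has_vector_derivative D) (at t within cbox 0 1)"
      using D has_real_derivative_iff_has_vector_derivative has_vector_derivative_at_within by blast
    show "(e has_vector_derivative 0) (at t within cbox 0 1)"
    proof (rule has_vector_derivative_transform[where f="\<lambda>_. e 0"])
      show "e s = e 0" if "s \<in> cbox 0 1" for s using e that unfolding box_real by blast
    qed (use t in auto)
  qed (use t in auto)
  then have "((\<lambda>s. e s *\<^sub>R ?m s) has_vector_derivative e t *\<^sub>R dt ?m t) (at t)"
    using has_vector_derivative_scaleR[OF D m] by simp
  then have "dt (\<lambda>s. e s *\<^sub>R ?m s) t = e t *\<^sub>R dt ?m t"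
    unfolding dt_def[of "\<lambda>s. e s *\<^sub>R ?m s"] by (rule vector_derivative_at)
  then show ?thesis using pW(2) by (simp add: Sigma_tensor_def Sigma_tensor_cov_def)
qed

text \<open>The equations differentiate S in \<xi> only. Agreement at times in [0,1], on the open
  slices of \<open>W1\<close>, therefore suffices.\<close>

lemma equations_of_motion_cong:
  assumes S: "\<And>t \<xi>. t \<in> {0..1} \<Longrightarrow> (t, \<xi>) \<in> W1 \<Longrightarrow> S t \<xi> = S' t \<xi>"
  shows "equations_of_motion Theta U e x B S \<longleftrightarrow> equations_of_motion Theta U e x B S'"
proof -
  have "divergence Theta x (upsilon Theta e x) S A t \<xi> = divergence Theta x (upsilon Theta e x) S' A t \<xi> \<and>
      f_Theta Theta x S A t \<xi> = f_Theta Theta x S' A t \<xi>" if t: "t \<in> {0..1}" "\<xi> \<in> B" for A t \<xi>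
  proof -
    have p: "(t, \<xi>) \<in> W1" using t Z_subset_W1 by auto
    have "open (Pair t -` W1)" by (intro open_vimage open_W1 continuous_intros)
    then have "pd \<alpha> (\<lambda>\<eta>. upsilon Theta e x t \<eta> * Sigma_tilde Theta x S \<alpha> A t \<eta>) \<xi> =
        pd \<alpha> (\<lambda>\<eta>. upsilon Theta e x t \<eta> * Sigma_tilde Theta x S' \<alpha> A t \<eta>) \<xi>" for \<alpha>
      unfolding pd_def by (rule dd_transform) (use p S t in \<open>auto simp: Sigma_tilde_def\<close>)
    then show ?thesis using S[OF t(1) p] by (simp add: divergence_def f_Theta_def)
  qed
  then show ?thesis by (simp add: equations_of_motion_def)
qed

end

text \<open>The equivalence for the covariant tensor carries the variational content. For constant
  \<open>e\<close> both tensors agree wherever the equations look, and the two weights of the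
  divergence differ by a factor constant along the body.\<close>

theorem mainTheorem11:
  fixes Theta :: "real^'n::finite \<Rightarrow> real^('k::finite + 'k \<Rightarrow> 'n)"
    and F0 :: "real^'d::finite \<Rightarrow> real^('k + 'k \<Rightarrow> 'd) \<Rightarrow> real^('k + 'k \<Rightarrow> 'd) \<Rightarrow> real"
    and U :: "real^'n \<Rightarrow> real"
    and e :: "real \<Rightarrow> real"
    and x :: "real \<Rightarrow> real^'d \<Rightarrow> real^'n"
    and M :: "(real^'n) set" and B N :: "(real^'d) set"
    and G :: "(real \<times> (real^'d)) set" and J :: "real set"
  assumes arith: "\<exists>m::int. 3 ^ CARD('k) - 2 * int CARD('k) * int CARD('d) ^ (CARD('k) - 1) = 4 * m + 1"
    and M: "open M" "smooth_on Theta M" "smooth_on U M"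
    and body: "compact B" "closure (interior B) = B"
    and energy: "open N" "B \<subseteq> N" "smooth_on (\<lambda>(\<xi>, D, V). F0 \<xi> D V) (N \<times> UNIV \<times> UNIV)"
    and metric: "open J" "{0..1} \<subseteq> J" "smooth_on e J" "\<forall>t\<in>{0..1}. e t > 0"
    and history: "open G" "{0..1} \<times> B \<subseteq> G" "smooth_on (\<lambda>(t, \<xi>). x t \<xi>) G"
      "\<forall>t\<in>{0..1}. embedding_on B (x t) \<and> x t ` B \<subseteq> M"
    and nondeg: "\<forall>t\<in>{0..1}. \<forall>\<xi>\<in>B. nondegenerate (pullback Theta (x t) \<xi>)"
  shows "(extremal Theta F0 U e B x \<longleftrightarrow>
            equations_of_motion Theta U e x B (Sigma_tensor_cov Theta F0 U e x)) \<and>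
         ((\<forall>t\<in>{0..1}. e t = e 0) \<longrightarrow>
            (extremal Theta F0 U e B x \<longleftrightarrow>
               equations_of_motion Theta U e x B (Sigma_tensor Theta F0 U x))) \<and>
         (\<forall>S\<in>{Sigma_tensor Theta F0 U x, Sigma_tensor_cov Theta F0 U e x}.
          \<forall>A. \<forall>t\<in>{0..1}. \<forall>\<xi>\<in>B.
            divergence Theta x (upsilon Theta e x) S A t \<xi> = divergence Theta x (varpi Theta x) S A t \<xi>)"
proof -
  interpret elastic_history Theta F0 U e x M B N G J
    by (rule elastic_history.intro[OF M body energy metric(1-3) _ history(1-3) _ _])
       (use metric(4) history(4) nondeg in \<open>auto simp: image_subset_iff\<close>)
  have iff: "extremal Theta F0 U e B x \<longleftrightarrow> equations_of_motion Theta U e x B Scov"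
    by (simp only: extremal_iff_motion_defect equations_of_motion_cov_iff)
  moreover have "extremal Theta F0 U e B x \<longleftrightarrow> equations_of_motion Theta U e x B (Sigma_tensor Theta F0 U x)"
    if "\<forall>t\<in>{0..1}. e t = e 0"
    unfolding iff by (rule equations_of_motion_cong) (simp add: Sigma_tensor_eq_cov[OF that])
  moreover have "divergence Theta x (upsilon Theta e x) S A t \<xi> = divergence Theta x (varpi Theta x) S A t \<xi>"
    if "S \<in> {Sigma_tensor Theta F0 U x, Scov}" "t \<in> {0..1}" "\<xi> \<in> B" for S A t \<xi>
  proof (rule divergence_upsilon_eq_varpi[OF open_W1 order_refl])
    show "smooth_on (case_prod S) W1"
      using that(1) smooth_on_Sigma_tensor_cov smooth_on_subset[OF smooth_on_Sigma_tensor W1_subset] by auto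
  qed (use that Z_subset_W1 in auto)
  ultimately show ?thesis by blast
qed

end
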